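(* Let $M_{\rm Rob}\subset X_{\rm Rob}$ be the unique minimal subshift contained in the Robinson shift $X_{\rm Rob}$. Then $\mathrm{Sym}(M_{\rm Rob},\mathbb{Z}^2)\cong\mathbb{Z}^2\rtimes D_4$, where $D_4$ is the dihedral group of order $8$.
   Context: For a finite alphabet $\mathcal{A}$, $\mathcal{A}^{\mathbb{Z}^2}$ carries the product topology of the discrete topology and the shift action $(\sigma_{\vec{g}}(x))_{\vec{h}}=x_{\vec{h}-\vec{g}}$. A subshift is a closed shift-invariant subset; it is minimal if it is nonempty and contains no proper nonempty subshift. An extended symmetry of a subshift $X\subseteq\mathcal{A}^{\mathbb{Z}^2}$ is a bijective continuous map $f:X\to X$ for which there is $A\in\mathrm{GL}_2(\mathbb{Z})$ with $f\circ\sigma_{\vec{p}}=\sigma_{A\vec{p}}\circ f$ for all $\vec{p}\in\mathbb{Z}^2$; these form the group $\mathrm{Sym}(X,\mathbb{Z}^2)$ under composition. Robinson tiles. Each tile is a unit square $[0,1]^2$ whose edges carry arrow heads and arrow tails, of two colors (black, red), at marked points. The five basic tiles are (markings listed by edge point): Tile 1: black tail at top $(\frac12,1)$, black head at bottom $(\frac12,0)$, black tails at left $(0,\frac12)$ and right $(1,\frac12)$. Tile 2: the markings of Tile 1, together with a red tail at $(\frac14,1)$, a red head at $(\frac14,0)$, and red tails at $(0,\frac14)$ and $(1,\frac14)$. Tile 3 (the cross): black heads at $(\frac12,1),(\frac12,0),(0,\frac12),(1,\frac12)$, and red heads at $(\frac14,1)$ and $(1,\frac14)$. Tile 4: the markings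 of Tile 1, together with red tails at $(0,\frac14)$ and $(1,\frac14)$. Tile 5: the markings of Tile 1, together with a red tail at $(\frac14,1)$ and a red head at $(\frac14,0)$. The alphabet consists of all rotations (by multiples of $\pi/2$) and reflections of these five tiles; this gives 28 symbols. Rotations of Tile 3 are called crosses. The Robinson shift $X_{\rm Rob}\subset\mathcal{A}^{\mathbb{Z}^2}$ is the set of configurations (the tile $x_{(i,j)}$ is placed on the square $[i,i+1]\times[j,j+1]$) such that: (1) on each edge shared by two adjacent tiles, every arrow head of one tile is in contact (same point, same color) with an arrow tail of the other tile, and every arrow tail is in contact with an arrow head; (2) there is $\vec{k}\in\mathbb{Z}^2$ such that all tiles at positions in $2\mathbb{Z}\times2\mathbb{Z}+\vec{k}$ are crosses; (3) any other cross is at a position in $2\mathbb{Z}\times2\mathbb{Z}+\vec{k}+(1,1)$. It is known that $X_{\rm Rob}$ is nonempty and contains a unique minimal subshift $M_{\rm Rob}$. *)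

theory Defs
  imports "HOL-Analysis.Analysis" "HOL-Algebra.Bij" "HOL-Algebra.Elementary_Groups"
begin

(* The lattice Z^2 is the type int^2; a configuration over 'a is a function int^2 => 'a.
   An alphabet is a set A :: 'a set, so no topology on the type 'a is involved. *)

type_synonym 'a config = "int^2 \<Rightarrow> 'a"

definition full_shift :: "'a set \<Rightarrow> 'a config topology" where
  "full_shift A = product_topology (\<lambda>_. discrete_topology A) UNIV"

definition shift :: "int^2 \<Rightarrow> 'a config \<Rightarrow> 'a config" where
  "shift g x = (\<lambda>h. x (h - g))"

definition subshift :: "'a set \<Rightarrow> 'a config set \<Rightarrow> bool" where
  "subshift A X \<longleftrightarrow> closedin (full_shift A) X \<and> (\<forall>g. shift g ` X = X)"

definition minimal_subshift :: "'a set \<Rightarrow> 'a config set \<Rightarrow> bool" where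
  "minimal_subshift A X \<longleftrightarrow>
     subshift A X \<and> X \<noteq> {} \<and> (\<forall>Y. subshift A Y \<and> Y \<noteq> {} \<and> Y \<subseteq> X \<longrightarrow> Y = X)"

definition GL2Z :: "(int^2^2) monoid" where
  "GL2Z = \<lparr>carrier = {A. invertible A}, mult = (**), one = mat 1\<rparr>"

definition extended_symmetry :: "'a set \<Rightarrow> 'a config set \<Rightarrow> ('a config \<Rightarrow> 'a config) \<Rightarrow> bool" where
  "extended_symmetry A X f \<longleftrightarrow>
     bij_betw f X X \<and>
     continuous_map (subtopology (full_shift A) X) (subtopology (full_shift A) X) f \<and>
     (\<exists>M \<in> carrier GL2Z. \<forall>p. \<forall>x\<in>X. f (shift p x) = shift (M *v p) (f x))"

(* A self-map of X is represented by its extension by undefined outside X (this is built into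
   Bij X), and the multiplication of BijGroup X is composition on X. *)
definition Sym :: "'a set \<Rightarrow> 'a config set \<Rightarrow> ('a config \<Rightarrow> 'a config) monoid" where
  "Sym A X = (BijGroup X)\<lparr>carrier := {f \<in> Bij X. extended_symmetry A X f}\<rparr>"

definition semidirect_product ::
    "('n, 'm) monoid_scheme \<Rightarrow> ('h, 'k) monoid_scheme \<Rightarrow> ('h \<Rightarrow> 'n \<Rightarrow> 'n) \<Rightarrow> ('n \<times> 'h) monoid" where
  "semidirect_product N H \<phi> =
     \<lparr>carrier = carrier N \<times> carrier H,
      mult = (\<lambda>(a, g) (b, h). (a \<otimes>\<^bsub>N\<^esub> \<phi> g b, g \<otimes>\<^bsub>H\<^esub> h)),
      one = (\<one>\<^bsub>N\<^esub>, \<one>\<^bsub>H\<^esub>)\<rparr>"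

definition Z2 :: "(int^2) monoid" where
  "Z2 = \<lparr>carrier = UNIV, mult = (+), one = 0\<rparr>"

(* The symmetry group of the square, generated by the rotation by pi/2 and the reflection in
   the vertical axis; it acts on Z^2 by matrix multiplication. *)
definition D4 :: "(int^2^2) monoid" where
  "D4 = subgroup_generated GL2Z
     {vector [vector [0, -1], vector [1, 0]], vector [vector [-1, 0], vector [0, 1]]}"

(* A tile is the set of its markings: a point on the boundary of [0,1] x [0,1], a color, and
   whether an arrow head or an arrow tail is drawn there. *)

datatype color = Black | Red
datatype arrow_end = Head | Tail

type_synonym tile = "((rat \<times> rat) \<times> color \<times> arrow_end) set"

definition tile1 :: tile where
  "tile1 = {((1/2, 1), Black, Tail), ((1/2, 0), Black, Head),
            ((0, 1/2), Black, Tail), ((1, 1/2), Black, Tail)}"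

definition tile2 :: tile where
  "tile2 = tile1 \<union> {((1/4, 1), Red, Tail), ((1/4, 0), Red, Head),
                    ((0, 1/4), Red, Tail), ((1, 1/4), Red, Tail)}"

definition tile3 :: tile where
  "tile3 = {((1/2, 1), Black, Head), ((1/2, 0), Black, Head),
            ((0, 1/2), Black, Head), ((1, 1/2), Black, Head),
            ((1/4, 1), Red, Head), ((1, 1/4), Red, Head)}"

definition tile4 :: tile where
  "tile4 = tile1 \<union> {((0, 1/4), Red, Tail), ((1, 1/4), Red, Tail)}"

definition tile5 :: tile where
  "tile5 = tile1 \<union> {((1/4, 1), Red, Tail), ((1/4, 0), Red, Head)}"

(* Counterclockwise rotation by pi/2 about (1/2,1/2), and reflection in the line u = 1/2. *)
definition rotate_tile :: "tile \<Rightarrow> tile" where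
  "rotate_tile t = (\<lambda>((u, v), m). ((1 - v, u), m)) ` t"

definition reflect_tile :: "tile \<Rightarrow> tile" where
  "reflect_tile t = (\<lambda>((u, v), m). ((1 - u, v), m)) ` t"

definition rotations :: "tile \<Rightarrow> tile set" where
  "rotations t = range (\<lambda>k. (rotate_tile ^^ k) t)"

definition robinson_tiles :: "tile set" where
  "robinson_tiles =
     (\<Union>t \<in> {tile1, tile2, tile3, tile4, tile5}. rotations t \<union> rotations (reflect_tile t))"

definition crosses :: "tile set" where
  "crosses = rotations tile3"

fun opposite_end :: "arrow_end \<Rightarrow> arrow_end" where
  "opposite_end Head = Tail"
| "opposite_end Tail = Head"

(* Here t is the right, respectively upper, neighbour of s. *)
definition match_horizontal :: "tile \<Rightarrow> tile \<Rightarrow> bool" where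
  "match_horizontal s t \<longleftrightarrow>
     (\<forall>v c e. ((1, v), c, e) \<in> s \<longleftrightarrow> ((0, v), c, opposite_end e) \<in> t)"

definition match_vertical :: "tile \<Rightarrow> tile \<Rightarrow> bool" where
  "match_vertical s t \<longleftrightarrow>
     (\<forall>u c e. ((u, 1), c, e) \<in> s \<longleftrightarrow> ((u, 0), c, opposite_end e) \<in> t)"

definition even_lattice :: "(int^2) set" where
  "even_lattice = {p. even (p $ 1) \<and> even (p $ 2)}"

definition X_Rob :: "tile config set" where
  "X_Rob = {x. (\<forall>p. x p \<in> robinson_tiles)
     \<and> (\<forall>p. match_horizontal (x p) (x (p + vector [1, 0])))
     \<and> (\<forall>p. match_vertical (x p) (x (p + vector [0, 1])))
     \<and> (\<exists>k. (\<forall>p. p - k \<in> even_lattice \<longrightarrow> x p \<in> crosses)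
          \<and> (\<forall>p. x p \<in> crosses \<longrightarrow>
               p - k \<in> even_lattice \<or> p - (k + vector [1, 1]) \<in> even_lattice))}"

end

theory Submission
  imports Defs
begin

text \<open>Off the coordinate axes there is an explicit hierarchical tiling \<open>hier\<close>: the tile at \<open>q\<close> is a
  cross iff the two coordinates have the same 2-adic valuation, and otherwise its arrow runs along the
  axis on which the valuation is smaller. The configurations \<open>rob_min\<close> that look locally like \<open>hier\<close>
  form a minimal subshift of \<open>X_Rob\<close>, so by uniqueness they are \<open>M_Rob\<close>. It is invariant
  under the dihedral group because \<open>hier\<close> is.

  Every \<open>x\<close> in \<open>rob_min\<close> has a phase modulo each power of 2, and two configurations with different
  phases differ along a full lattice \<open>2^n \<int>\<^sup>2\<close>. Two configurations with equal phases differ at most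
  on a row and a column, and then along a ray of one of them, since arrows carry their label
  along. An extended symmetry is a sliding block code, so it maps a pair of configurations that differ
  exactly on one column (or row) to a pair that differs only in a strip. The images therefore
  have equal phases and the strip contains a ray parallel to an axis. Hence the matrix permutes the
  axes up to sign. If the matrix is the identity, the images moreover have a singular column and a
  singular row at integer positions, and moving them to the axes turns the symmetry into one that
  agrees with the identity off the axes, hence everywhere.\<close>

text \<open>The label formula describes red squares. Crosses of level \<open>a\<close> are the
  points whose coordinates are both odd multiples of \<open>2 ^ a\<close>. In units of
  \<open>2 ^ a\<close>, the stretch from 1 to 3 mod 4 on a line of level \<open>a\<close> is a side
  of a square, so red accompanies exactly the quotients 1 and 2 mod 4, on the outer side of the
  black line. The centre of the square is a cross of level \<open>a + 1\<close>; its arms leave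
  through the midpoints of the sides, which is how consecutive levels fit together. The obstacle is
  the axes, where the valuation is infinite and \<open>hier\<close> fixes no labels. A configuration
  is therefore compared with \<open>hier\<close> in finite windows that miss the axes. This drives
  the origin of the comparison to infinity as the window grows, and only its residues modulo powers
  of 2 survive. A label of level \<open>a\<close> is a function of residues modulo
  \<open>2 ^ (a + 2)\<close>, so a phase modulo \<open>2 ^ Suc n\<close> controls only the levels
  below \<open>n\<close>: this is the power of 2 lost in most statements about phases.\<close>

lemma int2_eqI: "p $ 1 = q $ 1 \<Longrightarrow> p $ 2 = q $ 2 \<Longrightarrow> p = (q :: int^2)"
  by (simp add: vec_eq_iff forall_2)

definition other :: "2 \<Rightarrow> 2" where
  "other k = (if k = 1 then 2 else 1)"

lemma other_1 [simp]: "other 1 = 2" and other_2 [simp]: "other 2 = 1"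
  by (simp_all add: other_def)

lemma other_other [simp]: "other (other k) = k"
  using exhaust_2[of k] by auto

lemma other_neq [simp]: "other k \<noteq> k" "k \<noteq> other k"
  using exhaust_2[of k] by auto

lemma eq_or_other: "i = k \<or> i = other k"
  using exhaust_2[of k] exhaust_2[of i] by auto

section \<open>Edge labels from 2-adic valuations\<close>

abbreviation val2 :: "int \<Rightarrow> nat" where
  "val2 \<equiv> multiplicity 2"

lemma pow2_dvd_iff: "c \<noteq> 0 \<Longrightarrow> 2 ^ n dvd c \<longleftrightarrow> n \<le> val2 c"
  by (rule power_dvd_iff_le_multiplicity) auto

lemma val2_eqI: "2 ^ a dvd c \<Longrightarrow> \<not> 2 ^ Suc a dvd c \<Longrightarrow> val2 c = a"
  by (rule multiplicity_eqI) auto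

lemma val2_odd_part:
  assumes "c \<noteq> 0"
  obtains d where "c = 2 ^ val2 c * d" "odd d"
proof -
  obtain d where d: "c = 2 ^ val2 c * d" using multiplicity_dvd[of 2 c] by blast
  have "\<not> 2 ^ Suc (val2 c) dvd c" using assms by (subst pow2_dvd_iff) auto
  hence "\<not> 2 ^ val2 c * 2 dvd 2 ^ val2 c * d" using d by (metis power_Suc2)
  hence "odd d" by auto
  with d that show ?thesis by blast
qed

lemma val2_cong:
  assumes "\<not> 2 ^ n dvd c" "2 ^ n dvd c' - c"
  shows "val2 c' = val2 c" "val2 c < n"
proof -
  have c: "c \<noteq> 0" using assms(1) by auto
  show a: "val2 c < n" using assms(1) c by (simp add: pow2_dvd_iff)
  have "2 ^ k dvd c' \<longleftrightarrow> 2 ^ k dvd c" if "k \<le> n" for k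
  proof -
    have "2 ^ k dvd c' - c" using assms(2) that by (meson dvd_trans le_imp_power_dvd)
    thus ?thesis by (metis diff_add_cancel dvd_add_right_iff)
  qed
  moreover have "\<not> 2 ^ Suc (val2 c) dvd c" using c by (subst pow2_dvd_iff) auto
  ultimately show "val2 c' = val2 c"
    using a by (intro val2_eqI) (auto simp: multiplicity_dvd Suc_le_eq simp del: power_Suc)
qed

lemma zero_if_all_pow2_dvd:
  fixes d :: int
  assumes "\<And>n. 2 ^ n dvd d"
  shows "d = 0"
  using assms[of "Suc (val2 d)"] by (metis Suc_n_not_le_n pow2_dvd_iff)

type_synonym label = "bool \<times> bool option"

text \<open>The label of the edge from \<open>s\<close> to \<open>s + 1\<close> on the line with transversal coordinate \<open>c\<close>: whether
  the arrow points forward, and, if there is a red arrow next to it, whether that one sits at offset 1/4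
  (\<open>Some True\<close>) or 3/4 (\<open>Some False\<close>). Crosses on this line are the odd multiples of \<open>2 ^ val2 c\<close>. The
  value at \<open>c = 0\<close> is junk, as \<open>val2 0 = 0\<close>.\<close>

definition edge :: "int \<Rightarrow> int \<Rightarrow> label" where
  "edge c s = (let a = val2 c; k = s div 2 ^ a in
     (odd k, if k mod 4 \<in> {1, 2} then Some ((c div 2 ^ a) mod 4 = 1) else None))"

text \<open>The label reads both quotients by \<open>2 ^ a\<close> modulo 4 only. The level
  \<open>a\<close> is below \<open>n\<close>, so \<open>2 ^ a * 4\<close> divides
  \<open>2 ^ Suc n\<close>.\<close>

lemma edge_cong:
  assumes "\<not> 2 ^ n dvd c" "2 ^ Suc n dvd c' - c" "2 ^ Suc n dvd s' - s"
  shows "edge c' s' = edge c s"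
proof -
  have "2 ^ n dvd c' - c" using assms(2) by (meson dvd_trans le_imp_power_dvd lessI less_imp_le)
  note v = val2_cong[OF assms(1) this]
  define a where "a = val2 c"
  have *: "t' div 2 ^ a mod 4 = t div 2 ^ a mod 4 \<and> odd (t' div 2 ^ a) = odd (t div 2 ^ a)"
    if "2 ^ Suc n dvd t' - t" for t t' :: int
  proof -
    have "(2::int) ^ a * 4 dvd 2 ^ Suc n"
      using v(2) le_imp_power_dvd[of "a + 2" "Suc n" "2::int"] by (simp add: a_def power_add mult.commute)
    with that have "2 ^ a * 4 dvd t' - t" by (rule dvd_trans[rotated])
    then obtain j where "t' - t = 2 ^ a * 4 * j" by blast
    hence "t' = t + 2 ^ a * (4 * j)" by simp
    hence "t' div 2 ^ a = t div 2 ^ a + 4 * j" by simp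
    thus ?thesis by simp
  qed
  show ?thesis unfolding edge_def Let_def v(1) using *[OF assms(2)] *[OF assms(3)]
    by (simp add: a_def)
qed

text \<open>The quotient jumps only at multiples of \<open>2 ^ val2 c\<close>; everywhere else an
  arrow hands its label on unchanged.\<close>

lemma edge_prev:
  assumes "\<not> 2 ^ val2 c dvd s"
  shows "edge c (s - 1) = edge c s"
proof -
  have "(s - 1) div 2 ^ val2 c = s div 2 ^ val2 c"
  proof -
    define m where "m = (2::int) ^ val2 c"
    have "m > 0" by (simp add: m_def)
    have "s mod m \<noteq> 0" using assms by (auto simp: m_def)
    hence "0 < s mod m" "s mod m < m"
      using pos_mod_sign[OF \<open>m > 0\<close>, of s] pos_mod_bound[OF \<open>m > 0\<close>, of s] by linarith+
    moreover have "s - 1 = m * (s div m) + (s mod m - 1)" by simp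
    ultimately show ?thesis unfolding m_def[symmetric]
      by (intro int_div_pos_eq[where r = "s mod m - 1"]) auto
  qed
  thus ?thesis by (simp add: edge_def)
qed

lemma div_pred: "(m * k - 1) div m = k - 1" if "m > 0" for m k :: int
  by (rule int_div_pos_eq[where r = "m - 1"]) (use that in \<open>auto simp: algebra_simps\<close>)

lemma edge_mult:
  "edge c (2 ^ val2 c * k) = (odd k, if k mod 4 \<in> {1, 2} then Some ((c div 2 ^ val2 c) mod 4 = 1) else None)"
  "edge c (2 ^ val2 c * k - 1) = (even k, if k mod 4 \<in> {2, 3} then Some ((c div 2 ^ val2 c) mod 4 = 1) else None)"
proof -
  show "edge c (2 ^ val2 c * k) = (odd k, if k mod 4 \<in> {1, 2} then Some ((c div 2 ^ val2 c) mod 4 = 1) else None)"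
    by (simp add: edge_def)
  have "(k - 1) mod 4 \<in> {1, 2} \<longleftrightarrow> k mod 4 \<in> {2, 3}" by (simp, presburger)
  thus "edge c (2 ^ val2 c * k - 1) = (even k, if k mod 4 \<in> {2, 3} then Some ((c div 2 ^ val2 c) mod 4 = 1) else None)"
    by (simp add: edge_def div_pred Let_def)
qed

text \<open>Reflection sends the edge from \<open>s\<close> to \<open>s + 1\<close> to the edge from
  \<open>- s - 1\<close> to \<open>- s\<close>. A quotient \<open>k\<close> becomes
  \<open>- k - 1\<close>, which reverses parity and exchanges the residues 1 and 2 mod 4.\<close>

lemma edge_reflect:
  "edge c (- s - 1) = (\<not> fst (edge c s), snd (edge c s))"
proof -
  define m where "m = (2::int) ^ val2 c"
  have m: "m > 0" by (simp add: m_def)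
  have "(- s - 1) div m = - (s div m) - 1"
  proof (rule int_div_pos_eq[where r = "m - 1 - s mod m"])
    show "- s - 1 = m * (- (s div m) - 1) + (m - 1 - s mod m)"
      using mult_div_mod_eq[of m s] by (simp add: algebra_simps)
  qed (use pos_mod_sign[OF m, of s] pos_mod_bound[OF m, of s] in linarith)+
  moreover have "(- k - 1) mod 4 \<in> {1, 2} \<longleftrightarrow> k mod 4 \<in> {1, 2}" for k :: int by (simp, presburger)
  ultimately show ?thesis by (simp add: edge_def Let_def m_def)
qed

lemma edge_reflect': "edge c (- s) = (\<not> fst (edge c (s - 1)), snd (edge c (s - 1)))"
  using edge_reflect[of c "s - 1"] by simp

text \<open>Negation exchanges the odd residues 1 and 3 mod 4, so red moves to the mirror-image
  offset, while level and direction stay.\<close>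

lemma edge_uminus:
  assumes "c \<noteq> 0"
  shows "edge (- c) s = (fst (edge c s), map_option Not (snd (edge c s)))"
proof -
  obtain d where d: "c = 2 ^ val2 c * d" "odd d" using val2_odd_part[OF assms] .
  have 1: "c div 2 ^ val2 c = d" using d(1) by (metis nonzero_mult_div_cancel_left power_not_zero zero_neq_numeral)
  have 2: "- c div 2 ^ val2 c = - d"
    using d(1) by (metis mult_minus_right nonzero_mult_div_cancel_left power_not_zero zero_neq_numeral)
  have "(- d) mod 4 = 1 \<longleftrightarrow> d mod 4 \<noteq> 1" using d(2) by presburger
  moreover have "val2 (- c) = val2 c"
    by (rule multiplicity_eqI) (use assms in \<open>auto simp: multiplicity_dvd pow2_dvd_iff simp del: power_Suc\<close>)
  ultimately show ?thesis using 1 2 by (simp add: edge_def Let_def)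
qed

lemma edge_through:
  assumes "s \<noteq> 0" "val2 s < val2 c"
  shows "edge c (s - 1) = edge c s"
  using assms by (intro edge_prev) (simp add: pow2_dvd_iff)

text \<open>Arrows leave the crosses, at odd multiples of \<open>2 ^ val2 c\<close>, and run into
  each other halfway, at even multiples.\<close>

lemma edge_heads:
  assumes "s \<noteq> 0" "c \<noteq> 0"
  shows "val2 s = val2 c \<Longrightarrow> fst (edge c s) \<and> \<not> fst (edge c (s - 1))"
    and "val2 s > val2 c \<Longrightarrow> \<not> fst (edge c s) \<and> fst (edge c (s - 1))"
proof -
  show "fst (edge c s) \<and> \<not> fst (edge c (s - 1))" if "val2 s = val2 c"
  proof -
    obtain d where "s = 2 ^ val2 s * d" "odd d" using val2_odd_part[OF assms(1)] .
    hence d: "s = 2 ^ val2 c * d" "odd d" using that by simp_all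
    thus ?thesis using edge_mult[of c d] by simp
  qed
  show "\<not> fst (edge c s) \<and> fst (edge c (s - 1))" if "val2 s > val2 c"
  proof -
    have "2 ^ Suc (val2 c) dvd s" using assms(1) that by (subst pow2_dvd_iff) auto
    then obtain j where "s = 2 ^ val2 c * (2 * j)" by (auto simp: mult.assoc elim: dvdE)
    thus ?thesis using edge_mult[of c "2 * j"] by simp
  qed
qed

section \<open>Tiles as sets of edge marks\<close>

definition marks :: "(rat \<Rightarrow> rat \<times> rat) \<Rightarrow> label \<Rightarrow> tile" where
  "marks P l = insert (P (1/2), Black, if fst l then Head else Tail)
     (case snd l of None \<Rightarrow> {}
      | Some low \<Rightarrow> {(P (if low then 1/4 else 3/4), Red, if fst l then Head else Tail)})"

definition flip :: "label \<Rightarrow> label" where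
  "flip l = (\<not> fst l, snd l)"

definition mirror :: "label \<Rightarrow> label" where
  "mirror l = (fst l, map_option Not (snd l))"

lemma flip_flip [simp]: "flip (flip l) = l"
  by (simp add: flip_def)

lemma mirror_mirror [simp]: "mirror (mirror l) = l"
  by (cases l; cases "snd l") (auto simp: mirror_def)

lemma flip_mirror: "flip (mirror l) = mirror (flip l)"
  by (simp add: flip_def mirror_def)

text \<open>\<open>F k\<close> and \<open>B k\<close> label the edges met in positive and negative direction of axis \<open>k\<close>. The labels
  \<open>B k\<close> are flipped because an arrow pointing forward enters the tile there, with its tail.\<close>

definition tile_of :: "(2 \<Rightarrow> label) \<Rightarrow> (2 \<Rightarrow> label) \<Rightarrow> tile" where
  "tile_of F B = marks (\<lambda>v. (1, v)) (F 1) \<union> marks (\<lambda>v. (0, v)) (flip (B 1))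
     \<union> marks (\<lambda>u. (u, 1)) (F 2) \<union> marks (\<lambda>u. (u, 0)) (flip (B 2))"

lemma marks_inj:
  assumes "inj P" "\<And>x m. (P x, m) \<in> marks P l \<longleftrightarrow> (P x, m) \<in> marks P l'"
  shows "l = l'"
proof -
  have P: "P x = P y \<longleftrightarrow> x = y" for x y using assms(1) by (simp add: inj_eq)
  have *: "(P (1/2), Black, Head) \<in> marks P l \<longleftrightarrow> fst l"
    "(\<exists>e. (P (1/4), Red, e) \<in> marks P l) \<longleftrightarrow> snd l = Some True"
    "(\<exists>e. (P (3/4), Red, e) \<in> marks P l) \<longleftrightarrow> snd l = Some False" for l
    by (auto simp: marks_def P split: option.splits)
  have "fst l = fst l'" using *(1)[of l] *(1)[of l'] assms(2) by simp
  moreover have "snd l = snd l'"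
    using *(2,3)[of l] *(2,3)[of l'] assms(2) by (cases "snd l"; cases "snd l'") auto
  ultimately show ?thesis by (simp add: prod_eq_iff)
qed

text \<open>Marks sit at offsets 1/4, 1/2 and 3/4 of a side, never at a corner, so a point of one
  side cannot carry a mark of another.\<close>

lemma tile_of_sides:
  "((1, v), m) \<in> tile_of F B \<longleftrightarrow> ((1, v), m) \<in> marks (\<lambda>v. (1, v)) (F 1)"
  "((0, v), m) \<in> tile_of F B \<longleftrightarrow> ((0, v), m) \<in> marks (\<lambda>v. (0, v)) (flip (B 1))"
  "((u, 1), m) \<in> tile_of F B \<longleftrightarrow> ((u, 1), m) \<in> marks (\<lambda>u. (u, 1)) (F 2)"
  "((u, 0), m) \<in> tile_of F B \<longleftrightarrow> ((u, 0), m) \<in> marks (\<lambda>u. (u, 0)) (flip (B 2))"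
  by (auto simp: tile_of_def marks_def split: option.splits if_splits)

lemma tile_of_inj:
  assumes "tile_of F B = tile_of F' B'"
  shows "F = F'" "B = B'"
proof -
  note s = tile_of_sides[of _ _ F B, unfolded assms tile_of_sides]
  have "F' 1 = F 1" by (rule marks_inj[OF _ s(1)]) (simp add: inj_def)
  moreover have "F' 2 = F 2" by (rule marks_inj[OF _ s(3)]) (simp add: inj_def)
  moreover have "flip (B' 1) = flip (B 1)" by (rule marks_inj[OF _ s(2)]) (simp add: inj_def)
  moreover have "flip (B' 2) = flip (B 2)" by (rule marks_inj[OF _ s(4)]) (simp add: inj_def)
  ultimately have "F k = F' k" "B k = B' k" for k
    using exhaust_2[of k] by (auto dest: arg_cong[of _ _ flip])
  thus "F = F'" "B = B'" by auto
qed

lemma marks_flip: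
  assumes "inj P" "inj Q"
  shows "(P x, c, e) \<in> marks P l \<longleftrightarrow> (Q x, c, opposite_end e) \<in> marks Q (flip l)"
proof -
  have PQ: "P x = P y \<longleftrightarrow> x = y" "Q x = Q y \<longleftrightarrow> x = y" for x y
    using assms by (simp_all add: inj_eq)
  show ?thesis
    by (cases e) (auto simp: marks_def flip_def PQ split: option.splits)
qed

text \<open>The flip built into \<open>tile_of\<close> turns the matching rule into equality of the
  labels that the two tiles assign to their common edge.\<close>

lemma match_tile_of:
  "B' 1 = F 1 \<Longrightarrow> match_horizontal (tile_of F B) (tile_of F' B')"
  "B' 2 = F 2 \<Longrightarrow> match_vertical (tile_of F B) (tile_of F' B')"
  unfolding match_horizontal_def match_vertical_def tile_of_sides
  by (auto simp: inj_def intro!: marks_flip)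

lemma image_marks:
  "(\<lambda>(p, m). (f p, m)) ` marks P l = marks (f \<circ> P) l"
  by (auto simp: marks_def split: option.splits)

lemma marks_mirror: "marks (\<lambda>x. P (1 - x)) l = marks P (mirror l)"
  by (auto simp: marks_def mirror_def split: option.splits)

lemma rotate_tile_image: "rotate_tile t = (\<lambda>(p, m). ((1 - snd p, fst p), m)) ` t"
  unfolding rotate_tile_def by (rule image_cong) auto

lemma reflect_tile_image: "reflect_tile t = (\<lambda>(p, m). ((1 - fst p, snd p), m)) ` t"
  unfolding reflect_tile_def by (rule image_cong) auto

text \<open>Bottom and top become right and left with offsets kept, but outgoing and incoming
  direction of the axis are exchanged, whence \<open>flip\<close>. Right and left become top and
  bottom with offset \<open>v\<close> turned into \<open>1 - v\<close>, whence
  \<open>mirror\<close>.\<close>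

lemma rotate_tile_of:
  "rotate_tile (tile_of F B) =
     tile_of (\<lambda>k. if k = 1 then flip (B 2) else mirror (F 1)) (\<lambda>k. if k = 1 then flip (F 2) else mirror (B 1))"
  unfolding tile_of_def rotate_tile_image image_Un image_marks o_def
  by (simp add: marks_mirror[of "\<lambda>x. (x, _)"] flip_mirror Un_ac)

lemma reflect_tile_of:
  "reflect_tile (tile_of F B) =
     tile_of (\<lambda>k. if k = 1 then flip (B 1) else mirror (F 2)) (\<lambda>k. if k = 1 then flip (F 1) else mirror (B 2))"
  unfolding tile_of_def reflect_tile_image image_Un image_marks o_def
  by (simp add: marks_mirror[of "\<lambda>x. (x, _)"] flip_mirror Un_ac)

section \<open>Rotations and reflections of tiles, and finiteness of the alphabet\<close>

lemma rotate_tile_4: "(rotate_tile ^^ 4) t = t"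
  by (simp add: rotate_tile_def numeral_eq_Suc image_image case_prod_unfold)

lemma rotations_rotate: "t \<in> rotations s \<Longrightarrow> rotate_tile t \<in> rotations s"
  unfolding rotations_def by (auto intro: range_eqI[of _ _ "Suc _"])

lemma rotations_refl: "t \<in> rotations t"
  unfolding rotations_def by (metis funpow_0 rangeI)

lemma reflect_rotate: "reflect_tile (rotate_tile t) = (rotate_tile ^^ 3) (reflect_tile t)"
  by (simp add: rotate_tile_def reflect_tile_def numeral_eq_Suc image_image case_prod_unfold)

lemma reflect_reflect: "reflect_tile (reflect_tile t) = t"
  by (simp add: reflect_tile_def image_image case_prod_unfold)

lemma rotations_reflect: "t \<in> rotations s \<Longrightarrow> reflect_tile t \<in> rotations (reflect_tile s)"
proof -
  assume "t \<in> rotations s"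
  then obtain k where k: "t = (rotate_tile ^^ k) s" by (auto simp: rotations_def)
  have "reflect_tile ((rotate_tile ^^ k) s) \<in> rotations (reflect_tile s)"
    by (induction k) (simp_all add: rotations_refl reflect_rotate numeral_eq_Suc rotations_rotate)
  thus ?thesis using k by simp
qed

lemma robinson_tiles_rotate: "t \<in> robinson_tiles \<Longrightarrow> rotate_tile t \<in> robinson_tiles"
  unfolding robinson_tiles_def by (blast intro: rotations_rotate)

lemma robinson_tiles_reflect: "t \<in> robinson_tiles \<Longrightarrow> reflect_tile t \<in> robinson_tiles"
  unfolding robinson_tiles_def
  using rotations_reflect reflect_reflect by (metis (no_types, lifting) UN_E UN_I Un_iff)

lemma finite_robinson_tiles: "finite robinson_tiles"
proof -
  have "rotations s \<subseteq> (\<lambda>k. (rotate_tile ^^ k) s) ` {..<4}" for s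
  proof
    fix t assume "t \<in> rotations s"
    then obtain k where "t = (rotate_tile ^^ k) s" by (auto simp: rotations_def)
    also have "\<dots> = (rotate_tile ^^ (k mod 4)) s"
    proof -
      have "(rotate_tile ^^ (4 * j)) s = s" for j
        by (induction j) (simp_all add: funpow_add rotate_tile_4)
      hence "(rotate_tile ^^ (k mod 4 + 4 * (k div 4))) s = (rotate_tile ^^ (k mod 4)) s"
        by (simp only: funpow_add comp_apply)
      thus ?thesis by simp
    qed
    finally show "t \<in> (\<lambda>k. (rotate_tile ^^ k) s) ` {..<4}" by simp
  qed
  hence "finite (rotations s)" for s by (rule finite_subset) simp
  thus ?thesis by (simp add: robinson_tiles_def)
qed

section \<open>Label patterns that form Robinson tiles\<close>

lemma tile_of_cong2:
  "F 1 = F' 1 \<Longrightarrow> F 2 = F' 2 \<Longrightarrow> B 1 = B' 1 \<Longrightarrow> B 2 = B' 2 \<Longrightarrow> tile_of F B = tile_of F' B'"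
  by (simp add: tile_of_def)

text \<open>An arrow passes straight down and two transversal arrows run into it. Tiles 1, 2, 4 and
  5 are the four ways to add red at offset 1/4 to this pattern. Transversal red has to stay at 1/4,
  the side to which the arrow points; red along the arrow may move to 3/4, by reflection.\<close>

lemma robinson_down:
  assumes "F 1 = (False, rr)" "B 1 = (True, rr)" "rr \<in> {None, Some True}"
    "F 2 = (False, ro)" "B 2 = (False, ro)"
  shows "tile_of F B \<in> robinson_tiles"
proof -
  have base: "tile_of F B \<in> robinson_tiles"
    if "F 1 = (False, rr)" "B 1 = (True, rr)" "rr \<in> {None, Some True}"
      "F 2 = (False, ro)" "B 2 = (False, ro)" "ro \<in> {None, Some True}" for F B rr ro
  proof -
    have "tile_of F B \<in> {tile1, tile2, tile4, tile5}"
    proof -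
      have eq: "tile_of F B = marks (\<lambda>v. (1, v)) (False, rr) \<union> marks (\<lambda>v. (0, v)) (False, rr)
          \<union> marks (\<lambda>u. (u, 1)) (False, ro) \<union> marks (\<lambda>u. (u, 0)) (True, ro)"
        using that by (simp add: tile_of_def flip_def)
      have "rr = None \<or> rr = Some True" "ro = None \<or> ro = Some True" using that by auto
      thus ?thesis unfolding eq
        by (elim disjE)
          (simp_all add: marks_def tile1_def tile2_def tile4_def tile5_def insert_commute)
    qed
    thus ?thesis unfolding robinson_tiles_def using rotations_refl by blast
  qed
  show ?thesis
  proof (cases "ro = Some False")
    case False
    hence "ro \<in> {None, Some True}" by (cases ro) auto
    with base assms show ?thesis by blast
  next
    case True
    let ?F = "\<lambda>k. if k = 1 then flip (B 1) else mirror (F 2)"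
    let ?B = "\<lambda>k. if k = 1 then flip (F 1) else mirror (B 2)"
    have "tile_of ?F ?B \<in> robinson_tiles"
      by (rule base[of _ rr _ "Some True"]) (use assms True in \<open>auto simp: flip_def mirror_def\<close>)
    hence "reflect_tile (tile_of ?F ?B) \<in> robinson_tiles" by (rule robinson_tiles_reflect)
    moreover have "reflect_tile (tile_of ?F ?B) = tile_of F B"
      unfolding reflect_tile_of by (rule tile_of_cong2) simp_all
    ultimately show ?thesis by simp
  qed
qed

lemma robinson_unrotate:
  assumes "tile_of (\<lambda>k. if k = 1 then flip (B 2) else mirror (F 1)) (\<lambda>k. if k = 1 then flip (F 2) else mirror (B 1)) \<in> robinson_tiles"
  shows "tile_of F B \<in> robinson_tiles"
proof -
  have "rotate_tile (tile_of F B) \<in> robinson_tiles" unfolding rotate_tile_of by (rule assms)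
  hence "(rotate_tile ^^ 3) (rotate_tile (tile_of F B)) \<in> robinson_tiles"
    by (simp add: numeral_eq_Suc robinson_tiles_rotate)
  moreover have "(rotate_tile ^^ 3) (rotate_tile t) = t" for t
    using rotate_tile_4[of t] by (simp add: numeral_eq_Suc)
  ultimately show ?thesis by simp
qed

text \<open>Quarter turns bring the through arrow to the downward position: one if it points left,
  two if up, three if right. \<open>Some (\<not> d)\<close> keeps transversal red on the side to
  which the arrow points.\<close>

lemma robinson_through:
  assumes "F (other k) = (False, rr)" "B (other k) = (True, rr)" "rr \<in> {None, Some (\<not> d)}"
    "F k = (d, ro)" "B k = (d, ro)"
  shows "tile_of F B \<in> robinson_tiles"
proof -
  consider "k = 2" "\<not> d" | "k = 1" "\<not> d" | "k = 2" "d" | "k = 1" "d"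
    using exhaust_2[of k] by blast
  thus ?thesis
  proof cases
    case 1
    with assms show ?thesis by (intro robinson_down[of F rr B ro]) auto
  next
    case 2
    show ?thesis
      by (rule robinson_unrotate, rule robinson_down[of _ "rr" _ "map_option Not ro"])
        (use 2 assms in \<open>auto simp: flip_def mirror_def option.map_comp o_def\<close>)
  next
    case 3
    show ?thesis
      by (rule robinson_unrotate, rule robinson_unrotate, rule robinson_down[of _ "map_option Not rr" _ "map_option Not ro"])
        (use 3 assms in \<open>auto simp: flip_def mirror_def\<close>)
  next
    case 4
    show ?thesis
      by (rule robinson_unrotate, rule robinson_unrotate, rule robinson_unrotate, rule robinson_down[of _ "map_option Not rr" _ "ro"])
        (use 4 assms in \<open>auto simp: flip_def mirror_def option.map_comp o_def option.map_ident\<close>)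
  qed
qed

text \<open>A rotation-invariant trait of crosses that can be read off the labels; it shows that a
  tile with a through arrow is not a cross.\<close>

definition all_heads :: "tile \<Rightarrow> bool" where
  "all_heads t \<longleftrightarrow> (\<forall>p \<in> {(1/2, 1), (1/2, 0), (0, 1/2), (1, 1/2)}. (p, Black, Head) \<in> t)"

lemma crosses_all_heads:
  assumes "t \<in> crosses"
  shows "all_heads t"
proof -
  obtain k where k: "t = (rotate_tile ^^ k) tile3" using assms by (auto simp: crosses_def rotations_def)
  have "all_heads (rotate_tile t)" if "all_heads t" for t
    using that unfolding all_heads_def rotate_tile_def by (auto simp: image_iff Bex_def)
  moreover have "all_heads tile3" by (auto simp: all_heads_def tile3_def)
  ultimately have "all_heads ((rotate_tile ^^ k) tile3)" by (induction k) simp_all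
  thus ?thesis using k by simp
qed

lemma all_heads_tile_of: "all_heads (tile_of F B) \<longleftrightarrow> (\<forall>k. fst (F k) \<and> \<not> fst (B k))"
  by (auto simp: all_heads_def tile_of_sides forall_2 marks_def flip_def split: option.splits)

lemma crosses_subset: "crosses \<subseteq> robinson_tiles"
  by (auto simp: crosses_def robinson_tiles_def)

lemma crosses_unrotate:
  assumes "tile_of (\<lambda>k. if k = 1 then flip (B 2) else mirror (F 1)) (\<lambda>k. if k = 1 then flip (F 2) else mirror (B 1)) \<in> crosses"
  shows "tile_of F B \<in> crosses"
proof -
  have "rotate_tile (tile_of F B) \<in> crosses" unfolding rotate_tile_of by (rule assms)
  hence "(rotate_tile ^^ 3) (rotate_tile (tile_of F B)) \<in> crosses"
    by (simp add: numeral_eq_Suc rotations_rotate crosses_def)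
  moreover have "(rotate_tile ^^ 3) (rotate_tile t) = t" for t
    using rotate_tile_4[of t] by (simp add: numeral_eq_Suc)
  ultimately show ?thesis by simp
qed

lemma tile3_cross:
  assumes "\<And>k. F k = (True, Some True)" "\<And>k. B k = (False, None)"
  shows "tile_of F B \<in> crosses"
proof -
  have "tile_of F B = tile3"
    by (simp add: tile_of_def marks_def flip_def assms tile3_def; blast)
  thus ?thesis by (simp add: crosses_def rotations_refl)
qed

text \<open>Here \<open>r k\<close> says whether the red arm along axis \<open>k\<close> points
  forward. Red on one arm lies on the side away from the other red arm, so its offset is dictated by
  \<open>r (other k)\<close>. The four choices of \<open>r\<close> are the four rotations of
  \<open>tile3\<close>.\<close>

lemma tile_of_cross:
  assumes "\<And>k. F k = (True, if r k then Some (r (other k)) else None)"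
    "\<And>k. B k = (False, if r k then None else Some (r (other k)))"
  shows "tile_of F B \<in> crosses"
proof -
  consider "r 1" "r 2" | "r 1" "\<not> r 2" | "\<not> r 1" "r 2" | "\<not> r 1" "\<not> r 2" by blast
  thus ?thesis
  proof cases
    case 1
    have "r k" for k using exhaust_2[of k] 1 by auto
    thus ?thesis by (intro tile3_cross) (auto simp: assms)
  next
    case 2
    show ?thesis
      by (rule crosses_unrotate, rule tile3_cross)
        (use 2 assms in \<open>auto simp: flip_def mirror_def\<close>)
  next
    case 3
    show ?thesis
      by (rule crosses_unrotate, rule crosses_unrotate, rule crosses_unrotate, rule tile3_cross)
        (use 3 assms in \<open>auto simp: flip_def mirror_def\<close>)
  next
    case 4
    show ?thesis
      by (rule crosses_unrotate, rule crosses_unrotate, rule tile3_cross)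
        (use 4 assms in \<open>auto simp: flip_def mirror_def\<close>)
  qed
qed

lemma val2_power: "val2 (2 ^ k) = k"
  by (rule val2_eqI) (simp_all add: dvd_mult_cancel2)

section \<open>The hierarchical tiling and its phases\<close>

definition off_axes :: "int^2 \<Rightarrow> bool" where
  "off_axes q \<longleftrightarrow> (\<forall>i. q $ i \<noteq> 0)"

definition hier :: "tile config" where
  "hier q = tile_of (\<lambda>k. edge (q $ other k) (q $ k)) (\<lambda>k. edge (q $ other k) (q $ k - 1))"

lemma hier_inj:
  assumes "hier q = hier q'"
  shows "edge (q $ other k) (q $ k) = edge (q' $ other k) (q' $ k)"
    and "edge (q $ other k) (q $ k - 1) = edge (q' $ other k) (q' $ k - 1)"
  using tile_of_inj[OF assms[unfolded hier_def]] by (auto dest: fun_cong)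

lemma hier_eqI:
  assumes "\<And>k. edge (q $ other k) (q $ k) = edge (q' $ other k) (q' $ k)"
    and "\<And>k. edge (q $ other k) (q $ k - 1) = edge (q' $ other k) (q' $ k - 1)"
  shows "hier q = hier q'"
  using assms by (simp add: hier_def)

lemma hier_cong:
  assumes "\<And>i. \<not> 2 ^ n dvd q $ i" "\<And>i. 2 ^ Suc n dvd (q' - q) $ i"
  shows "hier q' = hier q"
proof (rule hier_eqI)
  fix k
  have *: "2 ^ Suc n dvd q' $ i - q $ i" for i using assms(2)[of i] by simp
  show "edge (q' $ other k) (q' $ k) = edge (q $ other k) (q $ k)"
    by (rule edge_cong[OF assms(1) * *])
  have "2 ^ Suc n dvd q' $ k - 1 - (q $ k - 1)" using *[of k] by simp
  thus "edge (q' $ other k) (q' $ k - 1) = edge (q $ other k) (q $ k - 1)"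
    by (rule edge_cong[OF assms(1) *])
qed

lemma val2_less_cases:
  obtains "val2 (q $ 1) = val2 (q $ 2)" | k where "val2 (q $ k) < val2 (q $ other k)"
  by (metis linorder_neqE_nat other_1 other_2)

lemma div_val2: "c \<noteq> 0 \<Longrightarrow> c = 2 ^ val2 c * (c div 2 ^ val2 c)" "c \<noteq> 0 \<Longrightarrow> odd (c div 2 ^ val2 c)"
proof -
  assume "c \<noteq> 0"
  then obtain d where d: "c = 2 ^ val2 c * d" "odd d" by (rule val2_odd_part)
  have "c div 2 ^ val2 c = d"
    using d(1) by (metis nonzero_mult_div_cancel_left power_not_zero zero_neq_numeral)
  thus "c = 2 ^ val2 c * (c div 2 ^ val2 c)" "odd (c div 2 ^ val2 c)"
    using d by auto
qed

lemma hier_cross: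
  assumes "off_axes q" "val2 (q $ 1) = val2 (q $ 2)"
  shows "hier q \<in> crosses"
proof -
  define a where "a = val2 (q $ 1)"
  have a: "val2 (q $ k) = a" for k using assms(2) exhaust_2[of k] by (auto simp: a_def)
  \<comment> \<open>Residue 1 mod 4 marks the beginning of a side of the red square, so the red arm
    runs forward; residue 3 marks its end.\<close>
  define r where "r k \<longleftrightarrow> (q $ k div 2 ^ a) mod 4 = 1" for k
  have d: "q $ k = 2 ^ a * (q $ k div 2 ^ a)" "odd (q $ k div 2 ^ a)" for k
    using div_val2[of "q $ k"] assms(1) a by (simp_all add: off_axes_def)
  have m: "x mod 4 = 2 \<longleftrightarrow> False" "x mod 4 = 3 \<longleftrightarrow> x mod 4 \<noteq> 1" if "odd x" for x :: int
    using that by presburger+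
  show ?thesis unfolding hier_def
  proof (rule tile_of_cross[where r = r])
    fix k
    note e = edge_mult[of "q $ other k" "q $ k div 2 ^ a", unfolded a, folded d(1)]
    show "edge (q $ other k) (q $ k) = (True, if r k then Some (r (other k)) else None)"
      unfolding e(1) using d(2)[of k] m[OF d(2)[of k]] by (simp add: r_def)
    show "edge (q $ other k) (q $ k - 1) = (False, if r k then None else Some (r (other k)))"
      unfolding e(2) using d(2)[of k] m[OF d(2)[of k]] by (simp add: r_def)
  qed
qed

text \<open>At unequal valuations the arrow on the line of higher level passes through. The
  transversal line has the smaller valuation \<open>a\<close> as its level, and its arrows meet at
  an even multiple of \<open>2 ^ a\<close>.\<close>

lemma hier_robinson:
  assumes "off_axes q"
  shows "hier q \<in> robinson_tiles"
proof (rule val2_less_cases[of q])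
  assume "val2 (q $ 1) = val2 (q $ 2)"
  thus ?thesis using hier_cross[OF assms] crosses_subset by blast
next
  fix k assume k: "val2 (q $ k) < val2 (q $ other k)"
  have nz: "q $ i \<noteq> 0" for i using assms by (simp add: off_axes_def)
  define a where "a = val2 (q $ k)"
  define e where "e = q $ k div 2 ^ a"
  have e: "odd e" using div_val2[of "q $ k"] nz by (simp add: a_def e_def)
  have "2 ^ Suc a dvd q $ other k" using k nz by (subst pow2_dvd_iff) (auto simp: a_def)
  then obtain j where j: "q $ other k = 2 ^ Suc a * j" by blast
  define rr where "rr = (if odd j then Some (e mod 4 = 1) else None)"
  have j': "q $ other k = 2 ^ a * (2 * j)" using j by simp
  have m: "2 * j mod 4 = (if odd j then 2 else 0)" by (simp, presburger)
  note edge = edge_mult[of "q $ k" "2 * j", folded a_def, folded j']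
  show ?thesis unfolding hier_def
  proof (rule robinson_through[where k = k and rr = rr])
    show "edge (q $ other (other k)) (q $ other k) = (False, rr)"
      using edge(1) m by (auto simp: rr_def e_def)
    show "edge (q $ other (other k)) (q $ other k - 1) = (True, rr)"
      using edge(2) m by (auto simp: rr_def e_def)
    show "edge (q $ other k) (q $ k) = (fst (edge (q $ other k) (q $ k)), snd (edge (q $ other k) (q $ k)))"
      by simp
    show "edge (q $ other k) (q $ k - 1) = (fst (edge (q $ other k) (q $ k)), snd (edge (q $ other k) (q $ k)))"
      using edge_through[OF nz k] by simp
    \<comment> \<open>For odd \<open>j\<close> the transversal red is a side of a square of level
      \<open>a\<close>, and \<open>q\<close> is its midpoint. The through arrow is an arm of the
      cross of level \<open>a + 1\<close> at the centre, so it points out of the square, to the side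
      on which the red line runs.\<close>
    show "rr \<in> {None, Some (\<not> fst (edge (q $ other k) (q $ k)))}"
    proof (cases "odd j")
      case True
      have "\<not> 2 ^ Suc (Suc a) dvd q $ other k"
      proof
        assume "2 ^ Suc (Suc a) dvd q $ other k"
        hence "2 ^ Suc a * 2 dvd 2 ^ Suc a * j" unfolding j by (simp add: mult.commute mult.left_commute)
        hence "2 dvd j" by (subst (asm) dvd_mult_cancel_left) simp
        thus False using True by simp
      qed
      hence "val2 (q $ other k) = Suc a" using j by (intro val2_eqI) auto
      moreover have "q $ k div 2 ^ Suc a = e div 2" by (simp add: e_def power_Suc2 zdiv_zmult2_eq del: power_Suc)
      ultimately have "fst (edge (q $ other k) (q $ k)) = odd (e div 2)"
        by (simp add: edge_def Let_def)
      moreover have "e mod 4 = 1 \<longleftrightarrow> even (e div 2)" using e by presburger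
      ultimately show ?thesis by (simp add: rr_def)
    qed (simp add: rr_def)
  qed
qed

lemma hier_crosses_iff:
  assumes "off_axes q"
  shows "hier q \<in> crosses \<longleftrightarrow> val2 (q $ 1) = val2 (q $ 2)"
proof
  assume "hier q \<in> crosses"
  hence "all_heads (hier q)" by (rule crosses_all_heads)
  hence h: "fst (edge (q $ other k) (q $ k))" "\<not> fst (edge (q $ other k) (q $ k - 1))" for k
    unfolding hier_def all_heads_tile_of by blast+
  show "val2 (q $ 1) = val2 (q $ 2)"
  proof (rule val2_less_cases[of q])
    fix k assume k: "val2 (q $ k) < val2 (q $ other k)"
    have "edge (q $ other k) (q $ k - 1) = edge (q $ other k) (q $ k)"
      using assms k by (intro edge_through) (auto simp: off_axes_def)
    thus ?thesis using h[of k] by simp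
  qed
qed (rule hier_cross[OF assms])

lemma hier_rotate:
  assumes "off_axes q" "q' $ 1 = - q $ 2" "q' $ 2 = q $ 1"
  shows "hier q' = rotate_tile (hier q)"
proof -
  have nz: "q $ i \<noteq> 0" for i using assms(1) by (simp add: off_axes_def)
  show ?thesis unfolding hier_def rotate_tile_of
    by (rule tile_of_cong2)
      (auto simp: assms(2,3) flip_def mirror_def edge_reflect edge_reflect' edge_uminus[OF nz])
qed

lemma hier_reflect:
  assumes "off_axes q" "q' $ 1 = - q $ 1" "q' $ 2 = q $ 2"
  shows "hier q' = reflect_tile (hier q)"
proof -
  have nz: "q $ i \<noteq> 0" for i using assms(1) by (simp add: off_axes_def)
  show ?thesis unfolding hier_def reflect_tile_of
    by (rule tile_of_cong2)
      (auto simp: assms(2,3) flip_def mirror_def edge_reflect edge_reflect' edge_uminus[OF nz])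
qed

section \<open>Finite windows and phases\<close>

definition square :: "nat \<Rightarrow> (int^2) set" where
  "square m = {p. \<forall>i. \<bar>p $ i\<bar> \<le> int m}"

lemma square_mono: "m \<le> m' \<Longrightarrow> p \<in> square m \<Longrightarrow> p \<in> square m'"
  by (auto simp: square_def intro: order_trans)

lemma finite_square: "finite (square m)"
proof -
  have "p \<in> (\<lambda>(a, b). vector [a, b]) ` ({- int m..int m} \<times> {- int m..int m})" if "p \<in> square m" for p
  proof (rule image_eqI[where x = "(p $ 1, p $ 2)"])
    show "p = (case (p $ 1, p $ 2) of (a, b) \<Rightarrow> vector [a, b])" by (simp add: int2_eqI)
    show "(p $ 1, p $ 2) \<in> {- int m..int m} \<times> {- int m..int m}"
      using that by (simp add: square_def abs_le_iff forall_2)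
  qed
  thus ?thesis by (meson finite_SigmaI finite_atLeastAtMost_int finite_imageI finite_subset subsetI)
qed

definition vsize :: "int^2 \<Rightarrow> nat" where
  "vsize p = nat \<bar>p $ 1\<bar> + nat \<bar>p $ 2\<bar>"

lemma vsize_square: "vsize p \<le> m \<Longrightarrow> p \<in> square m"
  unfolding vsize_def square_def mem_Collect_eq forall_2 by linarith

lemma square_add: "p \<in> square m \<Longrightarrow> q \<in> square m' \<Longrightarrow> p + q \<in> square (m + m')"
  unfolding square_def mem_Collect_eq forall_2 vector_add_component by linarith

lemma square_uminus: "p \<in> square m \<Longrightarrow> - p \<in> square m"
  by (simp add: square_def)

lemma square_diff: "p \<in> square m \<Longrightarrow> q \<in> square m' \<Longrightarrow> p - q \<in> square (m + m')"
  using square_add[OF _ square_uminus] by fastforce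

definition located :: "nat \<Rightarrow> int^2 \<Rightarrow> tile config \<Rightarrow> bool" where
  "located m g x \<longleftrightarrow> (\<forall>p \<in> square m. off_axes (p - g) \<and> x p = hier (p - g))"

definition rob_min :: "tile config set" where
  "rob_min = {x. \<forall>m. \<exists>g. located m g x}"

lemma located_mono: "located m' g x \<Longrightarrow> m \<le> m' \<Longrightarrow> located m g x"
  unfolding located_def using square_mono by blast

text \<open>A window around 0 that misses the axes seen from \<open>g\<close> forces every
  coordinate of \<open>g\<close> beyond \<open>m\<close> in absolute value. Hence no single
  \<open>g\<close> serves all windows, but a class modulo \<open>2 ^ n\<close> can.\<close>

definition phase :: "tile config \<Rightarrow> nat \<Rightarrow> int^2 \<Rightarrow> bool" where
  "phase x n c \<longleftrightarrow> (\<forall>m. \<exists>g. located m g x \<and> (\<forall>i. 2 ^ n dvd (g - c) $ i))"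

lemma phase_exists:
  assumes "x \<in> rob_min"
  shows "\<exists>c. phase x n c"
proof (rule ccontr)
  assume "\<nexists>c. phase x n c"
  hence "\<forall>c. \<exists>m. \<forall>g. located m g x \<longrightarrow> \<not> (\<forall>i. 2 ^ n dvd (g - c) $ i)"
    unfolding phase_def by meson
  then obtain m where m: "\<And>c g. located (m c) g x \<Longrightarrow> \<not> (\<forall>i. 2 ^ n dvd (g - c) $ i)" by metis
  \<comment> \<open>Pigeonhole: \<open>square (2 ^ n)\<close> contains a representative of every
    residue class, and a window of size \<open>M\<close> covers all those at which these classes are
    assumed to fail.\<close>
  define M where "M = Max (m ` square (2 ^ n))"
  obtain g where g: "located M g x" using assms unfolding rob_min_def by blast
  define c where "c = (\<chi> i. g $ i mod 2 ^ n)"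
  have "c \<in> square (2 ^ n)" by (auto simp: square_def c_def abs_le_iff less_imp_le intro: order_trans[of _ 0])
  hence "m c \<le> M" unfolding M_def by (intro Max_ge finite_imageI finite_square) auto
  with g have "located (m c) g x" by (rule located_mono)
  moreover have "2 ^ n dvd (g - c) $ i" for i by (simp add: c_def)
  ultimately show False using m by blast
qed

lemma phase_cong:
  assumes "phase x n c" "\<And>i. 2 ^ n' dvd (c - c') $ i" "n' \<le> n"
  shows "phase x n' c'"
  unfolding phase_def
proof
  fix m
  obtain g where g: "located m g x" "\<And>i. 2 ^ n dvd (g - c) $ i"
    using assms(1) unfolding phase_def by blast
  have "2 ^ n' dvd (g - c') $ i" for i
  proof -
    have "(2::int) ^ n' dvd 2 ^ n" using assms(3) by (rule le_imp_power_dvd)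
    hence "2 ^ n' dvd (g - c) $ i + (c - c') $ i" using g(2)[of i] assms(2)[of i] by (meson dvd_add dvd_trans)
    thus ?thesis by simp
  qed
  with g(1) show "\<exists>g. located m g x \<and> (\<forall>i. 2 ^ n' dvd (g - c') $ i)" by blast
qed

lemma phase_mono: "phase x n c \<Longrightarrow> n' \<le> n \<Longrightarrow> phase x n' c"
  by (rule phase_cong) auto

lemma phase_located:
  assumes "phase x n c"
  obtains g where "located m g x" "\<And>i. 2 ^ n dvd (g - c) $ i"
  using assms unfolding phase_def by blast

lemma phase_hier:
  assumes "phase x (Suc n) c" "\<And>i. \<not> 2 ^ n dvd (p - c) $ i"
  shows "x p = hier (p - c)"
proof -
  obtain g where g: "located (vsize p) g x" "\<And>i. 2 ^ Suc n dvd (g - c) $ i"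
    using phase_located[OF assms(1), where m = "vsize p"] by blast
  have "x p = hier (p - g)" using g(1) vsize_square[of p] by (auto simp: located_def)
  also have "\<dots> = hier (p - c)"
  proof (rule hier_cong[OF assms(2)])
    fix i
    have "(p - g - (p - c)) $ i = - ((g - c) $ i)" by simp
    thus "2 ^ Suc n dvd (p - g - (p - c)) $ i" using g(2)[of i] by (metis dvd_minus_iff)
  qed
  finally show ?thesis .
qed

text \<open>The position \<open>p0\<close> is chosen such that along some axis the tile of \<open>x\<close> has two black tails, whereas
  the tile of \<open>y\<close> has two black heads (a cross) or an arrow passing through.\<close>

lemma phase_recognition:
  assumes "phase x (Suc n) c" "phase y (Suc n) c'" "\<not> 2 ^ n dvd (c' - c) $ i"
  shows "\<exists>p0. \<forall>p. (\<forall>i. 2 ^ Suc n dvd (p - p0) $ i) \<longrightarrow> x p \<noteq> y p"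
proof -
  define d where "d = c' - c"
  have di: "d $ i \<noteq> 0" "val2 (d $ i) < n"
  proof -
    have nd: "\<not> 2 ^ n dvd d $ i" using assms(3) by (simp add: d_def)
    thus "d $ i \<noteq> 0" by (metis dvd_0_right)
    with nd show "val2 (d $ i) < n" by (simp add: pow2_dvd_iff)
  qed
  obtain j where j: "d $ j \<noteq> 0" "val2 (d $ j) < n" "2 ^ val2 (d $ j) dvd d $ other j"
  proof (cases "d $ other i = 0 \<or> val2 (d $ other i) \<ge> val2 (d $ i)")
    case True
    hence "2 ^ val2 (d $ i) dvd d $ other i"
      by (cases "d $ other i = 0") (simp_all add: pow2_dvd_iff)
    with di that[of i] show ?thesis by blast
  next
    case False
    hence "2 ^ val2 (d $ other i) dvd d $ other (other i)" using di by (simp add: pow2_dvd_iff)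
    with di that[of "other i"] False show ?thesis by auto
  qed
  define a where "a = val2 (d $ j)"
  \<comment> \<open>Seen from \<open>c\<close>, the point \<open>c + q\<close> has valuations
    \<open>a + 1\<close> along \<open>j\<close> and \<open>a\<close> across. Seen from
    \<open>c'\<close> it is \<open>q - d\<close>, of valuation exactly \<open>a\<close> along
    \<open>j\<close> and divisible by \<open>2 ^ a\<close> across. As \<open>a < n\<close>, all this
    survives a change modulo \<open>2 ^ Suc n\<close>.\<close>
  define q :: "int^2" where "q = (\<chi> k. if k = j then 2 ^ Suc a else 2 ^ a)"
  have nd: "\<not> (2::int) ^ Suc n dvd 2 ^ k" if "k \<le> n" for k
    using that by (subst pow2_dvd_iff) (simp_all add: val2_power)
  show ?thesis
  proof (intro exI[of _ "c + q"] allI impI)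
    fix p assume p: "\<forall>i. 2 ^ Suc n dvd (p - (c + q)) $ i"
    obtain g where g: "located (vsize p) g x" "\<And>i. 2 ^ Suc n dvd (g - c) $ i"
      using phase_located[OF assms(1), where m = "vsize p"] by blast
    obtain g' where g': "located (vsize p) g' y" "\<And>i. 2 ^ Suc n dvd (g' - c') $ i"
      using phase_located[OF assms(2), where m = "vsize p"] by blast
    define u where "u = p - g"
    define w where "w = p - g'"
    have u: "off_axes u" "x p = hier u" and w: "off_axes w" "y p = hier w"
      using g(1) g'(1) vsize_square[of p] by (auto simp: located_def u_def w_def)
    have uc: "2 ^ Suc n dvd u $ k - q $ k" for k
    proof -
      have "u $ k - q $ k = (p - (c + q)) $ k - (g - c) $ k" by (simp add: u_def)
      thus ?thesis using p g(2)[of k] by (metis dvd_diff)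
    qed
    have wc: "2 ^ Suc n dvd w $ k - (q $ k - d $ k)" for k
    proof -
      have "w $ k - (q $ k - d $ k) = (p - (c + q)) $ k - (g' - c') $ k" by (simp add: w_def d_def)
      thus ?thesis using p g'(2)[of k] by (metis dvd_diff)
    qed
    have uj: "val2 (u $ j) = Suc a"
      using val2_cong(1)[OF _ uc[of j]] nd[of "Suc a"] j(2) by (simp add: q_def a_def val2_power del: power_Suc)
    have uo: "val2 (u $ other j) = a"
      using val2_cong(1)[OF _ uc[of "other j"]] nd[of "a"] j(2) by (simp add: q_def a_def val2_power del: power_Suc)
    have an: "Suc a \<le> Suc n" using j(2) by (simp add: a_def)
    have dw: "2 ^ k dvd w $ l - (q $ l - d $ l)" if "k \<le> Suc n" for k l
      using wc[of l] le_imp_power_dvd[OF that, of "2::int"] dvd_trans by blast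
    have wj: "val2 (w $ j) = a"
    proof (rule val2_eqI)
      have "2 ^ a dvd d $ j" by (simp add: a_def multiplicity_dvd)
      moreover have "(2::int) ^ a dvd q $ j" by (simp add: q_def)
      ultimately have "2 ^ a dvd (w $ j - (q $ j - d $ j)) + (q $ j - d $ j)"
        using an by (intro dvd_add dvd_diff dw) auto
      thus "2 ^ a dvd w $ j" by simp
      have "\<not> 2 ^ Suc a dvd d $ j" using j(1) by (subst pow2_dvd_iff) (auto simp: a_def)
      show "\<not> 2 ^ Suc a dvd w $ j"
      proof
        assume "2 ^ Suc a dvd w $ j"
        hence "2 ^ Suc a dvd (w $ j - (q $ j - d $ j)) - w $ j + q $ j"
          using an by (intro dvd_add dvd_diff dw) (auto simp: q_def)
        with \<open>\<not> 2 ^ Suc a dvd d $ j\<close> show False by (simp del: power_Suc)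
      qed
    qed
    have "2 ^ a dvd (w $ other j - (q $ other j - d $ other j)) + (q $ other j - d $ other j)"
      using an j(3) by (intro dvd_add dvd_diff dw) (auto simp: q_def a_def)
    hence "2 ^ a dvd w $ other j" by simp
    hence wo: "a \<le> val2 (w $ other j)" using w(1) pow2_dvd_iff by (auto simp: off_axes_def)
    have ut: "\<not> fst (edge (u $ other j) (u $ j)) \<and> fst (edge (u $ other j) (u $ j - 1))"
      using u(1) by (intro edge_heads(2)) (auto simp: off_axes_def uj uo)
    show "x p \<noteq> y p"
    proof
      assume "x p = y p"
      hence e: "edge (u $ other j) (u $ j) = edge (w $ other j) (w $ j)"
        "edge (u $ other j) (u $ j - 1) = edge (w $ other j) (w $ j - 1)"
        using hier_inj[of u w] u(2) w(2) by auto
      show False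
      proof (cases "a = val2 (w $ other j)")
        case True
        hence "fst (edge (w $ other j) (w $ j))"
          using edge_heads(1)[of "w $ j" "w $ other j"] w(1) wj by (auto simp: off_axes_def)
        thus False using ut e by simp
      next
        case False
        hence "edge (w $ other j) (w $ j - 1) = edge (w $ other j) (w $ j)"
          using w(1) wj wo by (intro edge_through) (auto simp: off_axes_def)
        thus False using ut e by simp
      qed
    qed
  qed
qed

text \<open>Recognition is applied to \<open>x\<close> and itself: incompatible phases would make
  \<open>x\<close> differ from \<open>x\<close>.\<close>

lemma phase_unique:
  assumes "phase x (Suc n) c" "phase x (Suc n) c'"
  shows "2 ^ n dvd (c' - c) $ i"
proof (rule ccontr)
  assume "\<not> ?thesis"
  from phase_recognition[OF assms this] obtain p0
    where "\<And>p. \<forall>i. 2 ^ Suc n dvd (p - p0) $ i \<Longrightarrow> x p \<noteq> x p" by blast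
  from this[of p0] show False by simp
qed

section \<open>The minimal subshift\<close>

lemma finite_subset_square:
  assumes "finite S"
  obtains m where "S \<subseteq> square m"
proof
  show "S \<subseteq> square (Max (vsize ` S))"
    using assms by (auto intro!: vsize_square)
qed

lemma topspace_full_shift: "x \<in> topspace (full_shift A) \<longleftrightarrow> (\<forall>p. x p \<in> A)"
  by (simp add: full_shift_def PiE_UNIV_domain Pi_iff)

lemma openin_cylinder:
  assumes "\<And>p. x p \<in> A"
  shows "openin (full_shift A) {y \<in> topspace (full_shift A). \<forall>p \<in> square m. y p = x p}"
proof -
  let ?X = "\<lambda>p. if p \<in> square m then {x p} else A"
  have "openin (full_shift A) (\<Pi>\<^sub>E p\<in>UNIV. ?X p)"
    unfolding full_shift_def
  proof (rule product_topology_basis)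
    show "finite {p. ?X p \<noteq> topspace (discrete_topology A)}"
      by (rule finite_subset[OF _ finite_square[of m]]) auto
  qed (use assms in auto)
  moreover have "(\<Pi>\<^sub>E p\<in>UNIV. ?X p) = {y \<in> topspace (full_shift A). \<forall>p \<in> square m. y p = x p}"
    using assms by (force simp: topspace_full_shift PiE_UNIV_domain Pi_iff split: if_splits)
  ultimately show ?thesis by simp
qed

lemma openin_full_shift_contains_cylinder:
  assumes "openin (full_shift A) U" "x \<in> U"
  obtains m where "{y \<in> topspace (full_shift A). \<forall>p \<in> square m. y p = x p} \<subseteq> U"
proof -
  obtain X where X: "x \<in> (\<Pi>\<^sub>E p\<in>UNIV. X p)" "finite {p. X p \<noteq> A}" "(\<Pi>\<^sub>E p\<in>UNIV. X p) \<subseteq> U"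
    using product_topology_open_contains_basis[OF assms[unfolded full_shift_def]] by auto
  obtain m where m: "{p. X p \<noteq> A} \<subseteq> square m" using finite_subset_square[OF X(2)] .
  have "y \<in> U" if "\<forall>p. y p \<in> A" "\<forall>p \<in> square m. y p = x p" for y
  proof -
    have "y p \<in> X p" for p
    proof (cases "p \<in> square m")
      case True
      thus ?thesis using that(2) X(1) by auto
    next
      case False
      hence "X p = A" using m by auto
      thus ?thesis using that(1) by simp
    qed
    thus ?thesis using X(3) by auto
  qed
  thus thesis using that[of m] by (auto simp: topspace_full_shift)
qed

lemma closedin_full_shift_iff:
  "closedin (full_shift A) X \<longleftrightarrow> X \<subseteq> topspace (full_shift A) \<and>
     (\<forall>x \<in> topspace (full_shift A). (\<forall>m. \<exists>y\<in>X. \<forall>p\<in>square m. y p = x p) \<longrightarrow> x \<in> X)"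
proof (intro iffI conjI ballI impI)
  show "X \<subseteq> topspace (full_shift A)" if "closedin (full_shift A) X"
    using that by (rule closedin_subset)
next
  fix x assume X: "closedin (full_shift A) X" and x: "x \<in> topspace (full_shift A)"
    "\<forall>m. \<exists>y\<in>X. \<forall>p\<in>square m. y p = x p"
  show "x \<in> X"
  proof (rule ccontr)
    assume "x \<notin> X"
    hence "x \<in> topspace (full_shift A) - X" using x(1) by blast
    moreover have "openin (full_shift A) (topspace (full_shift A) - X)" using X by blast
    ultimately obtain m where m: "{y \<in> topspace (full_shift A). \<forall>p \<in> square m. y p = x p} \<subseteq> topspace (full_shift A) - X"
      using openin_full_shift_contains_cylinder[of A "topspace (full_shift A) - X" x] by blast
    obtain y where "y \<in> X" "\<forall>p\<in>square m. y p = x p" using x(2) by blast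
    with m closedin_subset[OF X] show False by blast
  qed
next
  assume X: "X \<subseteq> topspace (full_shift A) \<and>
     (\<forall>x \<in> topspace (full_shift A). (\<forall>m. \<exists>y\<in>X. \<forall>p\<in>square m. y p = x p) \<longrightarrow> x \<in> X)"
  have "openin (full_shift A) (topspace (full_shift A) - X)"
  proof (subst openin_subopen, intro ballI)
    fix x assume x: "x \<in> topspace (full_shift A) - X"
    then obtain m where m: "\<forall>y\<in>X. \<not> (\<forall>p\<in>square m. y p = x p)" using X by blast
    let ?C = "{y \<in> topspace (full_shift A). \<forall>p \<in> square m. y p = x p}"
    have "openin (full_shift A) ?C"
      using x by (intro openin_cylinder) (auto simp: topspace_full_shift)
    moreover have "x \<in> ?C" "?C \<subseteq> topspace (full_shift A) - X" using x m by auto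
    ultimately show "\<exists>T. openin (full_shift A) T \<and> x \<in> T \<and> T \<subseteq> topspace (full_shift A) - X" by blast
  qed
  thus "closedin (full_shift A) X" using X by (simp add: closedin_def)
qed

lemma compact_full_shift: "finite A \<Longrightarrow> compact_space (full_shift A)"
  by (simp add: full_shift_def compact_space_product_topology compact_space_discrete_topology)

lemma shift_0 [simp]: "shift 0 x = x"
  by (simp add: shift_def)

lemma shift_shift [simp]: "shift g (shift h x) = shift (g + h) x"
  by (simp add: shift_def fun_eq_iff algebra_simps)

lemma shift_apply: "shift g x p = x (p - g)"
  by (simp add: shift_def)

lemma shift_image_eqI:
  assumes "\<And>g x. x \<in> X \<Longrightarrow> shift g x \<in> X"
  shows "shift g ` X = X"
proof
  show "X \<subseteq> shift g ` X"
  proof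
    fix x assume "x \<in> X"
    hence "shift (- g) x \<in> X" "x = shift g (shift (- g) x)" using assms by auto
    thus "x \<in> shift g ` X" by blast
  qed
qed (use assms in auto)

section \<open>Closedness, recurrence and tiling rules of \<open>rob_min\<close>\<close>

lemma located_shift:
  assumes "located (m + vsize h) g x"
  shows "located m (g + h) (shift h x)"
  unfolding located_def
proof
  fix p assume "p \<in> square m"
  hence "p - h \<in> square (m + vsize h)" by (rule square_diff) (simp add: vsize_square)
  thus "off_axes (p - (g + h)) \<and> shift h x p = hier (p - (g + h))"
    using assms by (auto simp: located_def shift_apply algebra_simps)
qed

lemma rob_min_shift: "x \<in> rob_min \<Longrightarrow> shift h x \<in> rob_min"
  unfolding rob_min_def using located_shift by blast

lemma phase_shift:
  assumes "phase x n c"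
  shows "phase (shift h x) n (c + h)"
  unfolding phase_def
proof
  fix m
  obtain g where g: "located (m + vsize h) g x" "\<And>i. 2 ^ n dvd (g - c) $ i"
    using phase_located[OF assms, where m = "m + vsize h"] by blast
  have "2 ^ n dvd (g + h - (c + h)) $ i" for i using g(2)[of i] by simp
  with located_shift[OF g(1)]
  show "\<exists>g. located m g (shift h x) \<and> (\<forall>i. 2 ^ n dvd (g - (c + h)) $ i)" by blast
qed

lemma rob_min_located:
  assumes "x \<in> rob_min"
  obtains g where "off_axes (p - g)" "x p = hier (p - g)" "located m g x"
proof -
  obtain g where g: "located (m + vsize p) g x" using assms unfolding rob_min_def by blast
  have "p \<in> square (m + vsize p)" by (rule vsize_square) simp
  with g that[of g] located_mono[OF g, of m] show ?thesis by (auto simp: located_def)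
qed

lemma rob_min_tiles: "x \<in> rob_min \<Longrightarrow> x p \<in> robinson_tiles"
  by (metis rob_min_located hier_robinson)

lemma closedin_rob_min: "closedin (full_shift robinson_tiles) rob_min"
  unfolding closedin_full_shift_iff
proof (intro conjI ballI impI)
  show "rob_min \<subseteq> topspace (full_shift robinson_tiles)"
    by (auto simp: topspace_full_shift rob_min_tiles)
next
  fix x assume x: "\<forall>m. \<exists>y\<in>rob_min. \<forall>p\<in>square m. y p = x p"
  show "x \<in> rob_min" unfolding rob_min_def
  proof (intro CollectI allI)
    fix m
    obtain y where y: "y \<in> rob_min" "\<forall>p\<in>square m. y p = x p" using x by blast
    then obtain g where "located m g y" unfolding rob_min_def by blast
    thus "\<exists>g. located m g x" using y(2) by (auto simp: located_def)
  qed
qed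

lemma subshift_rob_min: "subshift robinson_tiles rob_min"
  unfolding subshift_def using closedin_rob_min rob_min_shift by (simp add: shift_image_eqI)

text \<open>In a bounded window off the axes the valuations are bounded, so residues modulo a power
  of 2 determine the pattern. It reappears in every \<open>x\<close> where the phase of
  \<open>x\<close> prescribes it; this makes every orbit dense in \<open>rob_min\<close>.\<close>

lemma hier_pattern_recurs:
  assumes "x \<in> rob_min" "\<And>p. p \<in> square m \<Longrightarrow> off_axes (p - g)"
  obtains h where "\<And>p. p \<in> square m \<Longrightarrow> x (p + h) = hier (p - g)"
proof -
  define n where "n = m + vsize g"
  have n: "\<bar>(p - g) $ i\<bar> < 2 ^ n" if "p \<in> square m" for p i
  proof -
    have "p - g \<in> square n" unfolding n_def using that by (rule square_diff) (simp add: vsize_square)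
    hence "\<bar>(p - g) $ i\<bar> \<le> int n" by (simp only: square_def mem_Collect_eq)
    also have "int n < 2 ^ n" by (metis less_exp of_nat_less_iff of_nat_numeral of_nat_power)
    finally show ?thesis .
  qed
  obtain c where c: "phase x (Suc n) c" using phase_exists[OF assms(1)] by blast
  have "x (p + (c - g)) = hier (p - g)" if "p \<in> square m" for p
  proof -
    have "\<not> 2 ^ n dvd (p - g) $ i" for i
    proof
      assume "2 ^ n dvd (p - g) $ i"
      moreover have "(p - g) $ i \<noteq> 0" using assms(2)[OF that] by (auto simp: off_axes_def)
      ultimately have "2 ^ n \<le> \<bar>(p - g) $ i\<bar>" by (metis dvd_imp_le_int abs_power2 power_abs abs_numeral)
      thus False using n[OF that, of i] by linarith
    qed
    moreover have "p + (c - g) - c = p - g" by simp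
    ultimately show ?thesis using phase_hier[OF c, of "p + (c - g)"] by metis
  qed
  thus thesis by (rule that)
qed

lemma minimal_rob_min:
  assumes "rob_min \<noteq> {}"
  shows "minimal_subshift robinson_tiles rob_min"
  unfolding minimal_subshift_def
proof (intro conjI allI impI)
  fix Y assume Y: "subshift robinson_tiles Y \<and> Y \<noteq> {} \<and> Y \<subseteq> rob_min"
  have "y \<in> Y" if y: "y \<in> rob_min" for y
  proof -
    obtain x where x: "x \<in> Y" "x \<in> rob_min" using Y by blast
    have "\<exists>z\<in>Y. \<forall>p\<in>square m. z p = y p" for m
    proof -
      obtain g where g: "located m g y" using y unfolding rob_min_def by blast
      obtain h where h: "\<And>p. p \<in> square m \<Longrightarrow> x (p + h) = hier (p - g)"
        using hier_pattern_recurs[OF x(2), of m g] g unfolding located_def by blast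
      have "shift (- h) x \<in> Y" using Y x(1) unfolding subshift_def by blast
      moreover have "\<forall>p\<in>square m. shift (- h) x p = y p"
        using h g by (simp add: shift_apply located_def)
      ultimately show ?thesis by blast
    qed
    moreover have "y \<in> topspace (full_shift robinson_tiles)"
      using y by (simp add: topspace_full_shift rob_min_tiles)
    ultimately show ?thesis using Y unfolding subshift_def closedin_full_shift_iff by blast
  qed
  thus "Y = rob_min" using Y by blast
qed (use assms subshift_rob_min in auto)

lemma hier_match:
  "match_horizontal (hier q) (hier (q + vector [1, 0]))"
  "match_vertical (hier q) (hier (q + vector [0, 1]))"
  unfolding hier_def by (intro match_tile_of; simp)+

lemma rob_min_X_Rob: "rob_min \<subseteq> X_Rob"
proof
  fix x assume x: "x \<in> rob_min"
  have match: "match_horizontal (x p) (x (p + vector [1, 0])) \<and> match_vertical (x p) (x (p + vector [0, 1]))" for p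
  proof -
    obtain g where g: "located (Suc (vsize p)) g x" using x unfolding rob_min_def by blast
    have "e \<in> square 1 \<Longrightarrow> p + e \<in> square (Suc (vsize p))" for e
      using square_add[of p "vsize p" e 1] by (simp add: vsize_square)
    moreover have "vector [1, 0] \<in> square 1" "vector [0, 1] \<in> square 1" "0 \<in> square 1"
      by (simp_all add: square_def forall_2)
    ultimately have "x (p + e) = hier (p - g + e)" if "e \<in> {vector [1, 0], vector [0, 1], 0}" for e
      using g that by (auto simp: located_def algebra_simps)
    from this[of "vector [1, 0]"] this[of "vector [0, 1]"] this[of 0] show ?thesis
      by (simp add: hier_match)
  qed
  obtain c where c: "phase x 1 c" using phase_exists[OF x] by blast
  have loc: "\<exists>g. off_axes (p - g) \<and> x p = hier (p - g) \<and> (\<forall>i. even ((p - g) $ i) \<longleftrightarrow> even ((p - c) $ i))" for p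
  proof -
    obtain g where g: "located (vsize p) g x" "\<And>i. 2 ^ 1 dvd (g - c) $ i"
      using phase_located[OF c, where m = "vsize p"] by blast
    have "even ((p - g) $ i) \<longleftrightarrow> even ((p - c) $ i)" for i using g(2)[of i] by auto
    thus ?thesis using g(1) vsize_square[of p] by (auto simp: located_def)
  qed
  have val_even: "val2 a = 0 \<longleftrightarrow> odd a" if "a \<noteq> 0" for a
    using pow2_dvd_iff[OF that, of 1] by auto
  \<comment> \<open>Seen from the phase, points with two odd coordinates have both valuations 0 and
    carry the required lattice of crosses. Equal valuations force equal parities, so any other cross
    has two even coordinates.\<close>
  let ?k = "c + vector [1, 1]"
  have "x p \<in> crosses" if "p - ?k \<in> even_lattice" for p
  proof -
    obtain g where g: "off_axes (p - g)" "x p = hier (p - g)"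
      "\<forall>i. even ((p - g) $ i) \<longleftrightarrow> even ((p - c) $ i)" using loc by blast
    have "odd ((p - c) $ 1)" "odd ((p - c) $ 2)" using that by (auto simp: even_lattice_def)
    hence "val2 ((p - g) $ 1) = 0" "val2 ((p - g) $ 2) = 0"
      using g(1,3) val_even by (auto simp: off_axes_def simp del: vector_minus_component)
    thus ?thesis using hier_cross[OF g(1)] g(2) by simp
  qed
  moreover have "p - ?k \<in> even_lattice \<or> p - (?k + vector [1, 1]) \<in> even_lattice" if "x p \<in> crosses" for p
  proof -
    obtain g where g: "off_axes (p - g)" "x p = hier (p - g)"
      "\<forall>i. even ((p - g) $ i) \<longleftrightarrow> even ((p - c) $ i)" using loc by blast
    have "val2 ((p - g) $ 1) = val2 ((p - g) $ 2)"
      using that hier_crosses_iff[OF g(1)] g(2) by simp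
    hence "odd ((p - g) $ 1) \<longleftrightarrow> odd ((p - g) $ 2)"
      using g(1) val_even by (metis off_axes_def)
    hence "odd ((p - c) $ 1) \<longleftrightarrow> odd ((p - c) $ 2)" using g(3) by blast
    thus ?thesis by (auto simp: even_lattice_def)
  qed
  ultimately show "x \<in> X_Rob"
    unfolding X_Rob_def using x rob_min_tiles match by blast
qed

section \<open>Fault lines\<close>

text \<open>The column (\<open>i = 1\<close>) or row (\<open>i = 2\<close>) of \<open>x\<close> at \<open>j\<close> has infinite valuation: it is a fault line.\<close>

definition singular :: "tile config \<Rightarrow> 2 \<Rightarrow> int \<Rightarrow> bool" where
  "singular x i j \<longleftrightarrow> (\<forall>n c. phase x (Suc n) c \<longrightarrow> 2 ^ n dvd j - c $ i)"

definition same_phase :: "tile config \<Rightarrow> tile config \<Rightarrow> bool" where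
  "same_phase x y \<longleftrightarrow> (\<forall>n. \<exists>c. phase x n c \<and> phase y n c)"

text \<open>Parallel fault lines are congruent modulo every power of 2.\<close>

lemma singular_unique:
  assumes "x \<in> rob_min" "singular x i j" "singular x i j'"
  shows "j = j'"
proof -
  have "2 ^ n dvd j - j'" for n
  proof -
    obtain c where "phase x (Suc n) c" using phase_exists[OF assms(1)] by blast
    hence "2 ^ n dvd (j - c $ i) - (j' - c $ i)" using assms(2,3) unfolding singular_def by (meson dvd_diff)
    thus ?thesis by simp
  qed
  hence "j - j' = 0" by (rule zero_if_all_pow2_dvd)
  thus ?thesis by simp
qed

lemma same_phase_singular:
  assumes "same_phase x y" "singular x i j"
  shows "singular y i j"
  unfolding singular_def
proof (intro allI impI)
  fix n c assume c: "phase y (Suc n) c"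
  obtain c' where c': "phase x (Suc n) c'" "phase y (Suc n) c'"
    using assms(1) unfolding same_phase_def by blast
  have "2 ^ n dvd (j - c' $ i) + (c' - c) $ i"
    using assms(2) c'(1) phase_unique[OF c c'(2)] unfolding singular_def by (meson dvd_add)
  thus "2 ^ n dvd j - c $ i" by simp
qed

text \<open>Off the fault lines both coordinates of \<open>p\<close> have bounded valuation, and the
  common phase modulo a large enough power of 2 determines the tile.\<close>

lemma same_phase_differ:
  assumes "same_phase x y" "x p \<noteq> y p"
  shows "\<exists>i. singular x i (p $ i)"
proof (rule ccontr)
  assume "\<nexists>i. singular x i (p $ i)"
  hence "\<forall>i. \<exists>n c. phase x (Suc n) c \<and> \<not> 2 ^ n dvd p $ i - c $ i"
    unfolding singular_def by blast
  then obtain \<nu> \<gamma> where \<nu>: "\<And>i. phase x (Suc (\<nu> i)) (\<gamma> i)" "\<And>i. \<not> 2 ^ \<nu> i dvd p $ i - \<gamma> i $ i"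
    by metis
  define n where "n = \<nu> 1 + \<nu> 2"
  obtain c where c: "phase x (Suc n) c" "phase y (Suc n) c"
    using assms(1) unfolding same_phase_def by blast
  have "\<not> 2 ^ n dvd (p - c) $ i" for i
  proof
    assume d: "2 ^ n dvd (p - c) $ i"
    have le: "\<nu> i \<le> n" using exhaust_2[of i] by (auto simp: n_def)
    have "2 ^ \<nu> i dvd (c - \<gamma> i) $ i"
      using phase_unique[OF \<nu>(1) phase_mono[OF c(1)], of i] le by simp
    moreover have "2 ^ \<nu> i dvd (p - c) $ i" using d le by (meson dvd_trans le_imp_power_dvd)
    ultimately have "2 ^ \<nu> i dvd (p - c) $ i + (c - \<gamma> i) $ i" by (rule dvd_add[rotated])
    thus False using \<nu>(2)[of i] by simp
  qed
  thus False using phase_hier[OF c(1)] phase_hier[OF c(2)] assms(2) by metis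
qed

text \<open>A high power of 2 divides the coordinate across the fault line but not the one along it,
  so the arrow on the fault line passes through the tile at \<open>p\<close>.\<close>

lemma singular_through:
  assumes "x \<in> rob_min" "singular x i (p $ i)" "\<not> singular x (other i) (p $ other i)" "p \<in> square m"
  obtains g where "located m g x" "val2 ((p - g) $ other i) < val2 ((p - g) $ i)"
proof -
  obtain n c where c: "phase x (Suc n) c" "\<not> 2 ^ n dvd p $ other i - c $ other i"
    using assms(3) unfolding singular_def by blast
  obtain g where g: "located m g x" "\<And>i. 2 ^ Suc n dvd (g - c) $ i"
    using phase_located[OF c(1), where m = m] by blast
  have g': "2 ^ n dvd (g - c) $ k" for k using g(2)[of k] by (meson dvd_trans le_imp_power_dvd lessI less_imp_le)
  have "2 ^ n dvd (p $ i - c $ i) - (g - c) $ i"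
    using assms(2) c(1) g'[of i] unfolding singular_def by (meson dvd_diff)
  hence 1: "2 ^ n dvd (p - g) $ i" by simp
  have 2: "\<not> 2 ^ n dvd (p - g) $ other i"
  proof
    assume "2 ^ n dvd (p - g) $ other i"
    hence "2 ^ n dvd (p - g) $ other i + (g - c) $ other i" using g'[of "other i"] by (rule dvd_add)
    thus False using c(2) by simp
  qed
  have "(p - g) $ k \<noteq> 0" for k using g(1) assms(4) unfolding located_def off_axes_def by blast
  hence "val2 ((p - g) $ other i) < val2 ((p - g) $ i)"
    using 1 2 pow2_dvd_iff[of "(p - g) $ i" n] pow2_dvd_iff[of "(p - g) $ other i" n] by fastforce
  with g(1) show ?thesis by (rule that)
qed

lemma axis_square: "axis k 1 \<in> square 1" "- axis k 1 \<in> square 1"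
  by (simp_all add: square_def axis_def)

lemma hier_neighbour:
  assumes "hier (u + axis k 1) = hier (w + axis k 1)"
  shows "edge (u $ other k) (u $ k) = edge (w $ other k) (w $ k)"
  using hier_inj(2)[OF assms, of k] by (simp add: axis_def)

lemma hier_neighbour':
  assumes "hier (u - axis k 1) = hier (w - axis k 1)"
  shows "edge (u $ other k) (u $ k - 1) = edge (w $ other k) (w $ k - 1)"
  using hier_inj(1)[OF assms, of k] by (simp add: axis_def)

lemma located_apply:
  assumes "located m g x" "p \<in> square m"
  shows "off_axes (p - g)" "x p = hier (p - g)"
  using assms by (auto simp: located_def)

text \<open>The neighbours across the fault line lie off all fault lines, where \<open>x\<close> and
  \<open>y\<close> agree, so they fix the two transversal labels. The other two labels at
  \<open>p\<close> equal each other because the arrow passes through; agreement at a neighbour on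
  the fault line would fix them too.\<close>

lemma difference_propagates:
  assumes "x \<in> rob_min" "y \<in> rob_min" "same_phase x y"
    and "singular x i (p $ i)" "\<not> singular x (other i) (p $ other i)" "x p \<noteq> y p"
    and e: "e = axis (other i) 1 \<or> e = - axis (other i) 1"
  shows "x (p + e) \<noteq> y (p + e)"
proof
  assume eq: "x (p + e) = y (p + e)"
  have sp: "same_phase y x" using assms(3) by (auto simp: same_phase_def)
  define m where "m = Suc (vsize p)"
  have pm: "p \<in> square m" by (rule vsize_square) (simp add: m_def)
  have pm': "p + e \<in> square m" if "e \<in> square 1" for e
    using square_add[OF vsize_square[of p "vsize p"] that] by (simp add: m_def)
  obtain g where g: "located m g x" "val2 ((p - g) $ other i) < val2 ((p - g) $ i)"
    using singular_through[OF assms(1,4,5) pm] .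
  have "singular y i (p $ i)" "\<not> singular y (other i) (p $ other i)"
    using same_phase_singular[OF assms(3,4)] same_phase_singular[OF sp] assms(5) by blast+
  then obtain g' where g': "located m g' y" "val2 ((p - g') $ other i) < val2 ((p - g') $ i)"
    using singular_through[OF assms(2) _ _ pm] by blast
  define u where "u = p - g"
  define w where "w = p - g'"
  have nz: "u $ k \<noteq> 0" "w $ k \<noteq> 0" for k
    using located_apply[OF g(1) pm] located_apply[OF g'(1) pm] by (auto simp: off_axes_def u_def w_def)
  have xy: "x (p + e) = hier (u + e)" "y (p + e) = hier (w + e)" if "e \<in> square 1" for e
    using located_apply(2)[OF g(1) pm'[OF that]] located_apply(2)[OF g'(1) pm'[OF that]]
    by (simp_all add: u_def w_def algebra_simps)
  have agree: "x (p + e) = y (p + e)" if "e = axis i 1 \<or> e = - axis i 1" for e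
  proof (rule ccontr)
    assume "x (p + e) \<noteq> y (p + e)"
    from same_phase_differ[OF assms(3) this] obtain k where "singular x k ((p + e) $ k)" by blast
    hence "singular x i ((p + e) $ i) \<or> singular x (other i) ((p + e) $ other i)"
      using eq_or_other[of k i] by auto
    moreover have "(p + e) $ other i = p $ other i" "(p + e) $ i \<noteq> p $ i"
      using that by (auto simp: axis_def)
    ultimately show False using assms(5) singular_unique[OF assms(1,4)] by metis
  qed
  have i: "edge (u $ other i) (u $ i) = edge (w $ other i) (w $ i)"
    "edge (u $ other i) (u $ i - 1) = edge (w $ other i) (w $ i - 1)"
    using agree[of "axis i 1"] agree[of "- axis i 1"] xy[OF axis_square(1)[of i]] xy[OF axis_square(2)[of i]]
    by (auto intro: hier_neighbour hier_neighbour')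
  have "hier (u + e) = hier (w + e)"
    using eq xy[of e] e axis_square[of "other i"] by auto
  hence "edge (u $ i) (u $ other i) = edge (w $ i) (w $ other i) \<or>
    edge (u $ i) (u $ other i - 1) = edge (w $ i) (w $ other i - 1)"
    using e hier_neighbour[of u "other i" w] hier_neighbour'[of u "other i" w] by auto
  moreover have "edge (u $ i) (u $ other i - 1) = edge (u $ i) (u $ other i)"
    "edge (w $ i) (w $ other i - 1) = edge (w $ i) (w $ other i)"
    using g(2) g'(2) nz by (auto intro!: edge_through simp: u_def w_def)
  ultimately have o: "edge (u $ i) (u $ other i) = edge (w $ i) (w $ other i)"
    "edge (u $ i) (u $ other i - 1) = edge (w $ i) (w $ other i - 1)" by auto
  have "hier u = hier w"
  proof (rule hier_eqI)
    fix k
    show "edge (u $ other k) (u $ k) = edge (w $ other k) (w $ k)"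
      "edge (u $ other k) (u $ k - 1) = edge (w $ other k) (w $ k - 1)"
      using eq_or_other[of k i] i o by auto
  qed
  thus False using assms(6) located_apply(2)[OF g(1) pm] located_apply(2)[OF g'(1) pm]
    by (simp add: u_def w_def)
qed

lemma difference_ray:
  assumes "x \<in> rob_min" "y \<in> rob_min" "same_phase x y"
    and "singular x i (p $ i)" "x p \<noteq> y p" "\<sigma> = 1 \<or> \<sigma> = - 1"
    and "\<And>t::nat. \<not> singular x (other i) (p $ other i + \<sigma> * int t)"
  shows "x (p + axis (other i) (\<sigma> * int t)) \<noteq> y (p + axis (other i) (\<sigma> * int t))"
proof (induction t)
  case 0
  have "p + axis (other i) (\<sigma> * int 0) = p" by (simp add: vec_eq_iff axis_def)
  thus ?case using assms(5) by (simp only: not_False_eq_True)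
next
  case (Suc t)
  let ?p = "p + axis (other i) (\<sigma> * int t)"
  have "x (?p + axis (other i) \<sigma>) \<noteq> y (?p + axis (other i) \<sigma>)"
  proof (rule difference_propagates[OF assms(1-3) _ _ Suc.IH])
    show "singular x i (?p $ i)" using assms(4) by (simp add: axis_def)
    show "\<not> singular x (other i) (?p $ other i)" using assms(7) by (simp add: axis_def)
    show "axis (other i) \<sigma> = axis (other i) 1 \<or> axis (other i) \<sigma> = - axis (other i) 1"
      using assms(6) by (auto simp: vec_eq_iff axis_def)
  qed
  moreover have "?p + axis (other i) \<sigma> = p + axis (other i) (\<sigma> * int (Suc t))"
    by (auto simp: vec_eq_iff axis_def algebra_simps)
  ultimately show ?case by simp
qed

text \<open>The point to be avoided is the crossing of two fault lines. Its four neighbours fix all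
  labels of its tile, so a difference there forces one at a neighbour, which lies on one fault line
  only.\<close>

lemma difference_transversal:
  assumes "x \<in> rob_min" "y \<in> rob_min" "same_phase x y" "x \<noteq> y"
  obtains p i where "x p \<noteq> y p" "singular x i (p $ i)" "\<not> singular x (other i) (p $ other i)"
proof -
  obtain p where p: "x p \<noteq> y p" using assms(4) by blast
  obtain i where i: "singular x i (p $ i)" using same_phase_differ[OF assms(3) p] by blast
  show ?thesis
  proof (cases "singular x (other i) (p $ other i)")
    case False
    with p i that show ?thesis by blast
  next
    case True
    with i have sing: "singular x k (p $ k)" for k using eq_or_other[of k i] by auto
    define m where "m = Suc (vsize p)"
    have pm: "p \<in> square m" by (rule vsize_square) (simp add: m_def)
    have pm': "p + e \<in> square m" if "e \<in> square 1" for e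
      using square_add[OF vsize_square[of p "vsize p"] that] by (simp add: m_def)
    obtain g where g: "located m g x" using assms(1) unfolding rob_min_def by blast
    obtain g' where g': "located m g' y" using assms(2) unfolding rob_min_def by blast
    define u where "u = p - g"
    define w where "w = p - g'"
    have xy: "x (p + e) = hier (u + e)" "y (p + e) = hier (w + e)" if "e \<in> square 1" for e
      using located_apply(2)[OF g pm'[OF that]] located_apply(2)[OF g' pm'[OF that]]
      by (simp_all add: u_def w_def algebra_simps)
    have "\<exists>k e. (e = axis k 1 \<or> e = - axis k 1) \<and> x (p + e) \<noteq> y (p + e)"
    proof (rule ccontr)
      assume "\<nexists>k e. (e = axis k 1 \<or> e = - axis k 1) \<and> x (p + e) \<noteq> y (p + e)"
      hence agree: "x (p + axis k 1) = y (p + axis k 1)" "x (p + - axis k 1) = y (p + - axis k 1)" for k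
        by blast+
      have "hier u = hier w"
      proof (rule hier_eqI)
        fix k
        show "edge (u $ other k) (u $ k) = edge (w $ other k) (w $ k)"
          using agree(1)[of k] xy[OF axis_square(1)[of k]] by (auto intro: hier_neighbour)
        show "edge (u $ other k) (u $ k - 1) = edge (w $ other k) (w $ k - 1)"
          using agree(2)[of k] xy[OF axis_square(2)[of k]] by (auto intro: hier_neighbour')
      qed
      thus False using p located_apply(2)[OF g pm] located_apply(2)[OF g' pm] by (simp add: u_def w_def)
    qed
    then obtain k e where e: "e = axis k 1 \<or> e = - axis k 1" "x (p + e) \<noteq> y (p + e)" by blast
    have "(p + e) $ other k = p $ other k" "(p + e) $ k \<noteq> p $ k" using e(1) by (auto simp: axis_def)
    hence "singular x (other k) ((p + e) $ other k)" "\<not> singular x k ((p + e) $ k)"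
      using sing[of "other k"] singular_unique[OF assms(1) sing[of k]] by metis+
    thus ?thesis using that[of "p + e" "other k"] e(2) by simp
  qed
qed

lemma same_phase_difference_ray:
  assumes "x \<in> rob_min" "y \<in> rob_min" "same_phase x y" "x \<noteq> y"
  obtains p i \<sigma> where "\<sigma> = 1 \<or> \<sigma> = - 1" "singular x i (p $ i)"
    "\<And>t::nat. x (p + axis (other i) (\<sigma> * int t)) \<noteq> y (p + axis (other i) (\<sigma> * int t))"
proof -
  obtain p i where p: "x p \<noteq> y p" "singular x i (p $ i)" "\<not> singular x (other i) (p $ other i)"
    using difference_transversal[OF assms] .
  \<comment> \<open>The ray points away from the transversal fault line, of which there is at most
    one, so that the arrow passes through all along it.\<close>
  obtain \<sigma> :: int where \<sigma>: "\<sigma> = 1 \<or> \<sigma> = - 1" "\<And>t::nat. \<not> singular x (other i) (p $ other i + \<sigma> * int t)"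
  proof (cases "\<exists>t::nat. singular x (other i) (p $ other i + int t)")
    case True
    then obtain t0 :: nat where t0: "singular x (other i) (p $ other i + int t0)" by blast
    hence "t0 \<noteq> 0" using p(3) by (intro notI) simp
    have "\<not> singular x (other i) (p $ other i + (- 1) * int t)" for t :: nat
      using singular_unique[OF assms(1) t0, of "p $ other i + (- 1) * int t"] \<open>t0 \<noteq> 0\<close> by auto
    thus ?thesis using that[of "- 1"] by blast
  next
    case False
    thus ?thesis using that[of 1] by simp
  qed
  show ?thesis
    using that[OF \<sigma>(1) p(2)] difference_ray[OF assms(1-3) p(2,1) \<sigma>] by blast
qed

text \<open>The labels with \<open>c = 0\<close> fill in the axes. The line where coordinate
  \<open>i\<close> vanishes carries a forward arrow throughout, accompanied by red iff
  \<open>b\<close>; on the other axis the arrows meet at the origin. Thus \<open>b\<close> is a free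
  choice that affects one line only.\<close>

definition central_label :: "2 \<Rightarrow> bool \<Rightarrow> 2 \<Rightarrow> int \<Rightarrow> int \<Rightarrow> label" where
  "central_label i b k c s =
     (if c \<noteq> 0 then edge c s
      else if k = i then (s < 0, None)
      else (True, if b then Some True else None))"

definition central :: "2 \<Rightarrow> bool \<Rightarrow> tile config" where
  "central i b p = tile_of (\<lambda>k. central_label i b k (p $ other k) (p $ k))
     (\<lambda>k. central_label i b k (p $ other k) (p $ k - 1))"

text \<open>As \<open>N\<close> grows, \<open>hier\<close> seen from \<open>central_point i b N\<close> converges to \<open>central i b\<close>.\<close>

definition central_point :: "2 \<Rightarrow> bool \<Rightarrow> nat \<Rightarrow> int^2" where
  "central_point i b N =
     (\<chi> k. if k = i then 2 ^ (N + 3) else (if b then 1 else 3) * 2 ^ (N + 3) + 2 ^ (N + 1))"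

lemma central_point_dvd: "2 ^ Suc N dvd central_point i b N $ k"
  by (auto simp: central_point_def power_add intro!: dvd_add)

lemma central_label_limit:
  assumes "\<bar>c\<bar> < 2 ^ N" "\<bar>s\<bar> \<le> 2 ^ N"
  shows "edge (c + central_point i b N $ other k) (s + central_point i b N $ k) = central_label i b k c s"
proof (cases "c = 0")
  case False
  have "\<not> 2 ^ N dvd c"
  proof
    assume "2 ^ N dvd c"
    hence "2 ^ N \<le> \<bar>c\<bar>" using False by (metis dvd_imp_le_int abs_power2 power_abs abs_numeral)
    thus False using assms(1) by simp
  qed
  hence "edge (c + central_point i b N $ other k) (s + central_point i b N $ k) = edge c s"
    by (rule edge_cong) (simp_all add: central_point_dvd del: power_Suc)
  thus ?thesis using False by (simp add: central_label_def)
next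
  case c: True
  let ?P = "(2::int) ^ N"
  have P: "?P > 0" by simp
  show ?thesis
  proof (cases "k = i")
    case True
    define B :: int where "B = (if b then 1 else 3)"
    \<comment> \<open>This line has level \<open>N + 1\<close>, and position \<open>s = 0\<close> on
      it is the fourth multiple of \<open>2 ^ Suc N\<close>. The quotients 3 and 4 on its two sides
      give arrows that meet there, without red.\<close>
    have co: "central_point i b N $ other k = 2 ^ Suc N * (4 * B + 1)"
      using True by (simp add: central_point_def B_def power_add algebra_simps)
    have v: "val2 (central_point i b N $ other k) = Suc N"
    proof (rule val2_eqI)
      have "\<not> 2 ^ Suc N * 2 dvd 2 ^ Suc N * (4 * B + 1)"
        by (subst dvd_mult_cancel_left) simp
      thus "\<not> 2 ^ Suc (Suc N) dvd central_point i b N $ other k" unfolding co by (simp add: mult.commute mult.left_commute)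
    qed (simp add: co)
    have "(s + central_point i b N $ k) div 2 ^ Suc N = (if s < 0 then 3 else 4)"
    proof (cases "s < 0")
      case True
      with \<open>k = i\<close> assms(2) P show ?thesis
        by (intro int_div_pos_eq[where r = "s + 2 * ?P"])
          (auto simp: central_point_def power_add)
    next
      case False
      hence "s < 2 * ?P" using assms(2) P by linarith
      with False \<open>k = i\<close> show ?thesis
        by (intro int_div_pos_eq[where r = "s"])
          (auto simp: central_point_def power_add)
    qed
    thus ?thesis using c v True by (simp add: edge_def central_label_def)
  next
    case False
    hence k: "k = other i" using eq_or_other by blast
    have co: "central_point i b N $ other k = 2 ^ (N + 3)" by (simp add: central_point_def k)
    have v: "val2 (2 ^ (N + 3)) = N + 3" by (rule val2_power)
    \<comment> \<open>This line has level \<open>N + 3\<close>, and the quotient 1 or 3 makes the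
      arrow forward, with or without red. The summand \<open>2 ^ (N + 1)\<close> in
      \<open>central_point\<close> keeps the quotient constant on the whole window.\<close>
    have "(s + central_point i b N $ k) div 2 ^ (N + 3) = (if b then 1 else 3)"
    proof (rule int_div_pos_eq[where r = "s + 2 * ?P"])
      have "- ?P \<le> s" "s \<le> ?P" using assms(2) by linarith+
      with P have "0 \<le> s + 2 * ?P" "s + 2 * ?P < 8 * ?P" by linarith+
      thus "0 \<le> s + 2 * ?P" "s + 2 * ?P < 2 ^ (N + 3)" by (simp_all add: power_add)
    qed (auto simp: central_point_def power_add k)
    thus ?thesis unfolding co using c v False
      by (simp add: edge_def Let_def central_label_def)
  qed
qed

lemma central_limit:
  assumes "p \<in> square m" "m < N"
  shows "off_axes (p + central_point i b N)" "central i b p = hier (p + central_point i b N)"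
proof -
  have m: "int m < 2 ^ m" "(2::int) ^ m < 2 ^ N" using assms(2) by simp_all
  have b: "\<bar>p $ k\<bar> + 1 < 2 ^ N" for k
  proof -
    have "\<bar>p $ k\<bar> \<le> int m" using assms(1) unfolding square_def by blast
    with m show ?thesis by linarith
  qed
  have "(p + central_point i b N) $ k \<noteq> 0" for k
  proof -
    have "central_point i b N $ k \<ge> 2 ^ N" by (auto simp: central_point_def power_add)
    with b[of k] show ?thesis unfolding vector_add_component by linarith
  qed
  thus "off_axes (p + central_point i b N)" by (simp add: off_axes_def)
  have "edge ((p + central_point i b N) $ other k) ((p + central_point i b N) $ k) = central_label i b k (p $ other k) (p $ k)" for k
    unfolding vector_add_component by (rule central_label_limit) (use b[of k] b[of "other k"] in linarith)+
  moreover have "edge ((p + central_point i b N) $ other k) ((p + central_point i b N) $ k - 1) = central_label i b k (p $ other k) (p $ k - 1)" for k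
  proof -
    have "edge (p $ other k + central_point i b N $ other k) ((p $ k - 1) + central_point i b N $ k) = central_label i b k (p $ other k) (p $ k - 1)"
      by (rule central_label_limit) (use b[of k] b[of "other k"] in linarith)+
    thus ?thesis by (simp add: algebra_simps)
  qed
  ultimately show "central i b p = hier (p + central_point i b N)"
    by (simp add: central_def hier_def)
qed

lemma located_central: "m < N \<Longrightarrow> located m (- central_point i b N) (central i b)"
  using central_limit by (auto simp: located_def)

lemma central_in_rob_min: "central i b \<in> rob_min"
  unfolding rob_min_def using located_central[OF lessI] by blast

lemma central_hier: "off_axes p \<Longrightarrow> central i b p = hier p"
  by (simp add: central_def hier_def central_label_def off_axes_def)

lemma central_agree: "p $ i \<noteq> 0 \<Longrightarrow> central i b p = central i b' p"
proof -
  assume "p $ i \<noteq> 0"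
  hence "central_label i b k (p $ other k) s = central_label i b' k (p $ other k) s" for k s
    using eq_or_other[of k i] by (auto simp: central_label_def)
  thus ?thesis by (simp add: central_def)
qed

lemma central_differ: "central i True \<noteq> central i False"
proof
  assume "central i True = central i False"
  hence "central i True 0 = central i False 0" by simp
  hence "central_label i True (other i) 0 0 = central_label i False (other i) 0 0"
    unfolding central_def by (auto dest!: tile_of_inj(1) dest: fun_cong[of _ _ "other i"])
  thus False by (simp add: central_label_def)
qed

section \<open>Rigidity of extended symmetries\<close>

text \<open>The Curtis-Hedlund-Lyndon argument, twisted by \<open>L\<close>: \<open>f x 0\<close> is
  locally constant in \<open>x\<close>, compactness gives one radius for all \<open>x\<close>, and
  equivariance carries the statement from 0 to \<open>L *v p\<close>.\<close>

lemma sliding_block_code: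
  fixes f :: "'a config \<Rightarrow> 'a config"
  assumes "finite A" and X: "subshift A X"
    and cont: "continuous_map (subtopology (full_shift A) X) (subtopology (full_shift A) X) f"
    and equiv: "\<And>p x. x \<in> X \<Longrightarrow> f (shift p x) = shift (L *v p) (f x)"
  obtains r where "\<And>x y p. x \<in> X \<Longrightarrow> y \<in> X \<Longrightarrow> \<forall>h\<in>square r. x (p + h) = y (p + h) \<Longrightarrow>
    f x (L *v p) = f y (L *v p)"
proof -
  let ?T = "full_shift A"
  let ?C = "\<lambda>x m. {y \<in> topspace ?T. \<forall>p\<in>square m. y p = x p}"
  have closed: "closedin ?T X" and sh: "\<And>g x. x \<in> X \<Longrightarrow> shift g x \<in> X"
    using X unfolding subshift_def by blast+
  have XT: "X \<subseteq> topspace ?T" using closed by (rule closedin_subset)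
  have "\<exists>m. \<forall>y\<in>X. (\<forall>p\<in>square m. y p = x p) \<longrightarrow> f y 0 = f x 0" if x: "x \<in> X" for x
  proof -
    have fX: "f y \<in> X" if "y \<in> X" for y
      using continuous_map_image_subset_topspace[OF cont] XT that by (auto simp: Int_absorb1)
    have "openin (subtopology ?T X) (?C (f x) 0 \<inter> X)"
      using XT fX[OF x] by (intro openin_subtopology_Int openin_cylinder) (auto simp: topspace_full_shift)
    hence "openin (subtopology ?T X) {y \<in> topspace (subtopology ?T X). f y \<in> ?C (f x) 0 \<inter> X}"
      using cont by (auto simp: continuous_map_def)
    then obtain V where V: "openin ?T V" "{y \<in> topspace (subtopology ?T X). f y \<in> ?C (f x) 0 \<inter> X} = V \<inter> X"
      unfolding openin_subtopology by blast
    have "x \<in> V" using V(2) x fX XT by auto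
    from openin_full_shift_contains_cylinder[OF V(1) this] obtain m where m: "?C x m \<subseteq> V" .
    have "f y 0 = f x 0" if "y \<in> X" "\<forall>p\<in>square m. y p = x p" for y
    proof -
      have "y \<in> V \<inter> X" using m that XT by blast
      hence "f y \<in> ?C (f x) 0" using V(2) by blast
      moreover have "0 \<in> square 0" by (simp add: square_def)
      ultimately show ?thesis by blast
    qed
    thus ?thesis by blast
  qed
  then obtain \<rho> where \<rho>: "\<And>x y. x \<in> X \<Longrightarrow> y \<in> X \<Longrightarrow> \<forall>p\<in>square (\<rho> x). y p = x p \<Longrightarrow> f y 0 = f x 0"
    by metis
  have "compactin ?T X"
    using closed compact_full_shift[OF \<open>finite A\<close>] by (rule closedin_compact_space[rotated])
  moreover have "openin ?T U" if U: "U \<in> (\<lambda>x. ?C x (\<rho> x)) ` X" for U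
  proof -
    obtain x where "x \<in> X" "U = ?C x (\<rho> x)" using U by blast
    moreover have "x p \<in> A" for p using \<open>x \<in> X\<close> XT topspace_full_shift by blast
    ultimately show ?thesis by (simp add: openin_cylinder)
  qed
  moreover have "X \<subseteq> \<Union> ((\<lambda>x. ?C x (\<rho> x)) ` X)" using XT by blast
  ultimately obtain F where F: "finite F" "F \<subseteq> (\<lambda>x. ?C x (\<rho> x)) ` X" "X \<subseteq> \<Union> F"
    unfolding compactin_def by meson
  obtain S where S: "S \<subseteq> X" "finite S" "F = (\<lambda>x. ?C x (\<rho> x)) ` S"
    using finite_subset_image[OF F(1,2)] by blast
  define r where "r = Max (\<rho> ` S)"
  have zero: "f x 0 = f y 0" if xy: "x \<in> X" "y \<in> X" "\<forall>h\<in>square r. x h = y h" for x y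
  proof -
    obtain z where z: "z \<in> S" "x \<in> ?C z (\<rho> z)" using F(3) S(3) xy(1) by blast
    have "\<rho> z \<le> r" unfolding r_def using S(2) z(1) by simp
    hence "\<forall>p\<in>square (\<rho> z). y p = x p" using xy(3) square_mono by metis
    hence "\<forall>p\<in>square (\<rho> z). y p = z p" "\<forall>p\<in>square (\<rho> z). x p = z p" using z(2) by auto
    thus ?thesis using \<rho>[of z x] \<rho>[of z y] z(1) S(1) xy by auto
  qed
  show ?thesis
  proof (rule that[of r])
    fix x y p assume xy: "x \<in> X" "y \<in> X" "\<forall>h\<in>square r. x (p + h) = y (p + h)"
    have "f (shift (- p) x) 0 = f (shift (- p) y) 0"
      using xy by (intro zero sh) (simp_all add: shift_apply add.commute)
    moreover have "L *v (- p) = - (L *v p)" by (simp add: vec_eq_iff matrix_vector_mult_def sum_negf)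
    ultimately show "f x (L *v p) = f y (L *v p)" using xy(1,2) by (simp add: equiv shift_apply)
  qed
qed

lemma mult_vec_2: "(L *v p) $ i = L $ i $ j * p $ j + L $ i $ other j * (p $ other j :: int)"
  using exhaust_2[of j] by (auto simp: matrix_vector_mult_def sum_2)

text \<open>What rigidity uses of an extended symmetry, with continuity replaced by a block code. It
  serves both the symmetry itself and, with \<open>L\<close> the identity, what is left after its
  linear part has been removed.\<close>

locale hierarchy_symmetry =
  fixes f :: "tile config \<Rightarrow> tile config" and L L' :: "int^2^2" and r :: nat
  assumes f_in: "x \<in> rob_min \<Longrightarrow> f x \<in> rob_min"
    and f_inj: "inj_on f rob_min"
    and L_inv: "L ** L' = mat 1" "L' ** L = mat 1"
    and equivariant: "x \<in> rob_min \<Longrightarrow> f (shift p x) = shift (L *v p) (f x)"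
    and block_code: "x \<in> rob_min \<Longrightarrow> y \<in> rob_min \<Longrightarrow> \<forall>h\<in>square r. x (p + h) = y (p + h) \<Longrightarrow>
      f x (L *v p) = f y (L *v p)"
begin

lemma L_L': "L *v (L' *v p) = p"
  by (simp add: matrix_vector_mul_assoc L_inv)

lemma differ_nearby:
  assumes "x \<in> rob_min" "y \<in> rob_min" "f x p \<noteq> f y p"
  shows "\<exists>h\<in>square r. x (L' *v p + h) \<noteq> y (L' *v p + h)"
  using block_code[OF assms(1,2), of "L' *v p"] assms(3) by (auto simp: L_L')

text \<open>Incompatible phases would make the images differ along a full lattice. Some point of
  that lattice pulls back under \<open>L'\<close> far from both axes, where \<open>x\<close> and
  \<open>y\<close> agree on the whole window read by the block code.\<close>

lemma image_same_phase:
  assumes "x \<in> rob_min" "y \<in> rob_min" "\<And>p. off_axes p \<Longrightarrow> x p = y p"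
  shows "same_phase (f x) (f y)"
  unfolding same_phase_def
proof
  fix n
  obtain c c' where c: "phase (f x) (Suc n) c" "phase (f y) (Suc n) c'"
    using phase_exists f_in assms(1,2) by metis
  have "2 ^ n dvd (c' - c) $ i" for i
  proof (rule ccontr)
    assume "\<not> 2 ^ n dvd (c' - c) $ i"
    from phase_recognition[OF c this] obtain p0
      where p0: "\<And>p. \<forall>i. 2 ^ Suc n dvd (p - p0) $ i \<Longrightarrow> f x p \<noteq> f y p" by blast
    define q0 where "q0 = L' *v p0"
    \<comment> \<open>Adding \<open>v\<close> keeps \<open>L *v (q0 + v)\<close> in the class of
      \<open>p0\<close> modulo \<open>2 ^ Suc n\<close>, and \<open>t\<close> is large enough to
      make \<open>q0 + v + h\<close> positive in both coordinates for every \<open>h\<close> in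
      \<open>square r\<close>.\<close>
    define t where "t = int (vsize q0 + r + 1)"
    define v :: "int^2" where "v = (\<chi> i. 2 ^ Suc n * t)"
    have "\<forall>i. 2 ^ Suc n dvd (L *v (q0 + v) - p0) $ i"
    proof
      fix i
      have "L *v (q0 + v) - p0 = L *v v"
        by (simp add: matrix_vector_right_distrib q0_def L_L')
      moreover have "(L *v v) $ i = 2 ^ Suc n * (L $ i $ 1 * t + L $ i $ 2 * t)"
        unfolding mult_vec_2[of L v i 1] by (simp add: v_def algebra_simps)
      ultimately show "2 ^ Suc n dvd (L *v (q0 + v) - p0) $ i" by simp
    qed
    from differ_nearby[OF assms(1,2) p0[OF this]]
    obtain h where h: "h \<in> square r" "x (L' *v (L *v (q0 + v)) + h) \<noteq> y (L' *v (L *v (q0 + v)) + h)" by blast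
    have "L' *v (L *v (q0 + v)) = q0 + v" by (simp add: matrix_vector_mul_assoc L_inv)
    moreover have "off_axes (q0 + v + h)"
      unfolding off_axes_def
    proof
      fix i
      have "q0 \<in> square (vsize q0)" by (rule vsize_square) simp
      hence "\<bar>q0 $ i\<bar> \<le> int (vsize q0)" "\<bar>h $ i\<bar> \<le> int r" using h(1) unfolding square_def by blast+
      moreover have "t \<le> v $ i"
      proof -
        have "(1::int) \<le> 2 ^ Suc n" by (rule one_le_power) simp
        hence "1 * t \<le> 2 ^ Suc n * t" by (rule mult_right_mono) (simp add: t_def)
        thus ?thesis by (simp add: v_def)
      qed
      ultimately have "0 < q0 $ i + v $ i + h $ i" unfolding t_def by linarith
      thus "(q0 + v + h) $ i \<noteq> 0" by simp
    qed
    ultimately show False using h(2) assms(3) by metis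
  qed
  hence "phase (f y) n c" by (intro phase_cong[OF c(2)]) auto
  moreover have "phase (f x) n c" using c(1) by (rule phase_mono) simp
  ultimately show "\<exists>c. phase (f x) n c \<and> phase (f y) n c" by blast
qed

text \<open>The two central configurations differ only where coordinate \<open>i\<close> vanishes,
  so the ray of differences between their images, pulled back by \<open>L'\<close>, stays within
  \<open>r\<close> of that line. Its coordinate \<open>i\<close> changes by
  \<open>L' $ i $ other j\<close> up to sign at each step, so this entry is 0.\<close>

lemma central_image:
  obtains j a where "L' $ i $ other j = 0" "singular (f (central i True)) j a"
proof -
  let ?x = "central i True" and ?y = "central i False"
  have xy: "?x \<in> rob_min" "?y \<in> rob_min" by (rule central_in_rob_min)+
  have "f ?x \<noteq> f ?y" using f_inj xy central_differ by (metis inj_onD)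
  moreover have "same_phase (f ?x) (f ?y)" using xy by (rule image_same_phase) (simp add: central_hier)
  ultimately obtain p j \<sigma> where ray: "\<sigma> = 1 \<or> \<sigma> = - 1" "singular (f ?x) j (p $ j)"
    "\<And>t::nat. f ?x (p + axis (other j) (\<sigma> * int t)) \<noteq> f ?y (p + axis (other j) (\<sigma> * int t))"
    using same_phase_difference_ray[OF f_in f_in, OF xy] by metis
  have bound: "\<bar>(L' *v p) $ i + L' $ i $ other j * (\<sigma> * int t)\<bar> \<le> int r" for t
  proof -
    let ?p = "p + axis (other j) (\<sigma> * int t)"
    obtain h where h: "h \<in> square r" "?x (L' *v ?p + h) \<noteq> ?y (L' *v ?p + h)"
      using differ_nearby[OF xy ray(3)] by blast
    hence "(L' *v ?p + h) $ i = 0" using central_agree by metis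
    moreover have "\<bar>h $ i\<bar> \<le> int r" using h(1) unfolding square_def by blast
    moreover have "(L' *v ?p) $ i = (L' *v p) $ i + L' $ i $ other j * (\<sigma> * int t)"
      by (simp add: mult_vec_2[of _ _ _ j] axis_def algebra_simps)
    ultimately show ?thesis by simp
  qed
  have "L' $ i $ other j = 0"
  proof (rule ccontr)
    assume nz: "L' $ i $ other j \<noteq> 0"
    define t where "t = nat \<bar>(L' *v p) $ i\<bar> + r + 1"
    have "int t \<le> \<bar>L' $ i $ other j\<bar> * int t" using nz by (intro mult_le_cancel_right1[THEN iffD2]) auto
    also have "\<dots> = \<bar>L' $ i $ other j * (\<sigma> * int t)\<bar>" using ray(1) by (auto simp: abs_mult)
    finally show False using bound[of t] unfolding t_def by linarith
  qed
  with ray(2) show ?thesis using that by blast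
qed

end

text \<open>The zero entry given by \<open>central_image\<close> lies off the diagonal of the
  identity, so the image of a central configuration has a fault line of either direction. They cross
  at \<open>g\<close>, and off them the image is \<open>hier\<close> seen from \<open>g\<close>.
  Near any position, every \<open>y\<close> agrees with a translate of a central configuration, so
  the block code extends the conclusion to \<open>y\<close>.\<close>

lemma equivariant_identity_is_shift:
  assumes "hierarchy_symmetry f (mat 1) (mat 1) r"
  obtains g where "\<And>y. y \<in> rob_min \<Longrightarrow> f y = shift g y"
proof -
  interpret hierarchy_symmetry f "mat 1" "mat 1" r by (rule assms)
  define x where "x = f (central 1 True)"
  have x: "x \<in> rob_min" unfolding x_def by (intro f_in central_in_rob_min)
  have "\<exists>a. singular x i a" for i
  proof -
    obtain j a where ja: "(mat 1 :: int^2^2) $ i $ other j = 0" "singular (f (central i True)) j a"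
      using central_image .
    hence "i \<noteq> other j" by (auto simp: mat_def)
    hence "j = i" using eq_or_other[of i j] by auto
    have "same_phase (f (central i True)) x"
      unfolding x_def by (intro image_same_phase central_in_rob_min) (simp add: central_hier)
    thus ?thesis using same_phase_singular ja(2) \<open>j = i\<close> by blast
  qed
  then obtain \<gamma> where \<gamma>: "\<And>i. singular x i (\<gamma> i)" by metis
  define g :: "int^2" where "g = (\<chi> i. \<gamma> i)"
  have x_hier: "x p = hier (p - g)" if off: "off_axes (p - g)" for p
  proof -
    \<comment> \<open>This \<open>n\<close> exceeds both valuations of \<open>p - g\<close>. The
      phase is taken modulo \<open>2 ^ Suc (Suc n)\<close>, because \<open>singular\<close> gives
      back only \<open>2 ^ Suc n\<close>, the modulus that \<open>hier_cong\<close> asks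
      for.\<close>
    define n where "n = Suc (val2 ((p - g) $ 1) + val2 ((p - g) $ 2))"
    have n: "\<not> 2 ^ n dvd (p - g) $ i" for i
    proof -
      have "val2 ((p - g) $ i) < n" using exhaust_2[of i] unfolding n_def by auto
      moreover have "(p - g) $ i \<noteq> 0" using off unfolding off_axes_def by blast
      ultimately show ?thesis by (simp only: pow2_dvd_iff not_le not_False_eq_True)
    qed
    obtain c where c: "phase x (Suc (Suc n)) c" using phase_exists[OF x] by blast
    obtain g0 where g0: "located (vsize p) g0 x" "\<And>i. 2 ^ Suc (Suc n) dvd (g0 - c) $ i"
      using phase_located[OF c, where m = "vsize p"] by blast
    have "x p = hier (p - g0)" using g0(1) vsize_square[of p] by (simp add: located_def)
    also have "\<dots> = hier (p - g)"
    proof (rule hier_cong[OF n])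
      fix i
      have "2 ^ Suc n dvd \<gamma> i - c $ i" using \<gamma>[of i] c unfolding singular_def by blast
      moreover have "2 ^ Suc n dvd (g0 - c) $ i"
        using g0(2)[of i] by (meson dvd_trans le_imp_power_dvd lessI less_imp_le)
      ultimately have "2 ^ Suc n dvd (\<gamma> i - c $ i) - (g0 - c) $ i" by (rule dvd_diff)
      thus "2 ^ Suc n dvd (p - g0 - (p - g)) $ i" by (simp add: g_def)
    qed
    finally show ?thesis .
  qed
  have "f y p = shift g y p" if y: "y \<in> rob_min" for y p
  proof -
    \<comment> \<open>The window contains both the block of radius \<open>r\<close> around
      \<open>p\<close> and the position \<open>p - g\<close> at which \<open>y\<close> is finally
      read.\<close>
    obtain g0 where g0: "located (vsize p + (vsize g + r)) g0 y" using y unfolding rob_min_def by blast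
    have sq: "p + h \<in> square (vsize p + (vsize g + r))" if "h \<in> square (vsize g + r)" for h
      using that by (rule square_add[OF vsize_square[OF order_refl]])
    have "- g \<in> square (vsize g + r)" by (intro square_uminus vsize_square) simp
    from located_apply[OF g0 sq[OF this]]
    have pg: "off_axes (p - g - g0)" "y (p - g) = hier (p - g - g0)" by simp_all
    have "y (p + h) = shift g0 (central 1 True) (p + h)" if "h \<in> square r" for h
    proof -
      have "h \<in> square (vsize g + r)" using square_mono[OF _ that] by simp
      from located_apply[OF g0 sq[OF this]] show ?thesis by (simp add: shift_apply central_hier)
    qed
    hence "f y (mat 1 *v p) = f (shift g0 (central 1 True)) (mat 1 *v p)"
      using y by (intro block_code rob_min_shift central_in_rob_min) auto
    also have "\<dots> = x (p - g0)"
      by (simp add: equivariant[OF central_in_rob_min] shift_apply x_def)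
    also have "\<dots> = hier (p - g0 - g)" using pg(1) by (intro x_hier) (simp add: algebra_simps)
    finally show ?thesis using pg(2) by (simp add: shift_apply algebra_simps)
  qed
  thus thesis using that by blast
qed

text \<open>A period \<open>d\<close> turns a phase \<open>c\<close> into the phase
  \<open>c + d\<close>, so uniqueness of phases makes every power of 2 divide
  \<open>d\<close>.\<close>

lemma rob_min_aperiodic:
  assumes "x \<in> rob_min" "shift d x = x"
  shows "d = 0"
proof -
  have "d $ i = 0" for i
  proof (rule zero_if_all_pow2_dvd)
    fix n
    obtain c where c: "phase x (Suc n) c" using phase_exists[OF assms(1)] by blast
    hence "phase x (Suc n) (c + d)" using phase_shift[OF c, of d] assms(2) by simp
    from phase_unique[OF c this, of i] show "2 ^ n dvd d $ i" by simp
  qed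
  thus ?thesis by (simp add: vec_eq_iff)
qed

section \<open>The dihedral action\<close>

text \<open>The linear action about the centre \<open>(1/2, 1/2)\<close> of the tile.\<close>

definition tile_act :: "int^2^2 \<Rightarrow> tile \<Rightarrow> tile" where
  "tile_act L t = (\<lambda>(p, m).
     ((of_int (L $ 1 $ 1) * (fst p - 1/2) + of_int (L $ 1 $ 2) * (snd p - 1/2) + 1/2,
       of_int (L $ 2 $ 1) * (fst p - 1/2) + of_int (L $ 2 $ 2) * (snd p - 1/2) + 1/2), m)) ` t"

lemma tile_act_mult: "tile_act (L ** K) t = tile_act L (tile_act K t)"
  unfolding tile_act_def image_image
  by (rule image_cong) (auto simp: matrix_matrix_mult_def sum_2 algebra_simps)

lemma tile_act_1 [simp]: "tile_act (mat 1) t = t"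
  by (simp add: tile_act_def mat_def case_prod_unfold)

definition quarter_turn :: "int^2^2" where
  "quarter_turn = vector [vector [0, -1], vector [1, 0]]"

definition axis_reflection :: "int^2^2" where
  "axis_reflection = vector [vector [-1, 0], vector [0, 1]]"

lemma tile_act_generators:
  "tile_act quarter_turn t = rotate_tile t" "tile_act axis_reflection t = reflect_tile t"
  unfolding tile_act_def rotate_tile_image reflect_tile_image
  by (rule image_cong; auto simp: quarter_turn_def axis_reflection_def)+

lemma mat2_eqI:
  "L $ 1 $ 1 = K $ 1 $ 1 \<Longrightarrow> L $ 1 $ 2 = K $ 1 $ 2 \<Longrightarrow> L $ 2 $ 1 = K $ 2 $ 1 \<Longrightarrow> L $ 2 $ 2 = K $ 2 $ 2
    \<Longrightarrow> L = (K :: int^2^2)"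
  by (simp add: vec_eq_iff forall_2)

section \<open>The group generated by the quarter turn and the reflection\<close>

lemma group_GL2Z: "group GL2Z"
proof (rule groupI)
  fix L assume "L \<in> carrier GL2Z"
  then obtain K :: "int^2^2" where "L ** K = mat 1" "K ** L = mat 1"
    by (auto simp: GL2Z_def invertible_def)
  thus "\<exists>K\<in>carrier GL2Z. K \<otimes>\<^bsub>GL2Z\<^esub> L = \<one>\<^bsub>GL2Z\<^esub>"
    by (auto simp: GL2Z_def invertible_def)
next
  fix L K assume "L \<in> carrier GL2Z" "K \<in> carrier GL2Z"
  then obtain L' K' :: "int^2^2" where "L ** L' = mat 1" "L' ** L = mat 1" "K ** K' = mat 1" "K' ** K = mat 1"
    by (auto simp: GL2Z_def invertible_def)
  hence "(L ** K) ** (K' ** L') = mat 1" "(K' ** L') ** (L ** K) = mat 1"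
    by (metis matrix_mul_assoc matrix_mul_rid)+
  thus "L \<otimes>\<^bsub>GL2Z\<^esub> K \<in> carrier GL2Z" by (auto simp: GL2Z_def invertible_def)
qed (auto simp: GL2Z_def matrix_mul_assoc invertible_def intro: matrix_mul_lid)

lemma GL2Z_simps [simp]:
  "L \<otimes>\<^bsub>GL2Z\<^esub> K = L ** K" "\<one>\<^bsub>GL2Z\<^esub> = mat 1"
  by (simp_all add: GL2Z_def)

lemma D4_simps [simp]: "L \<otimes>\<^bsub>D4\<^esub> K = L ** K" "\<one>\<^bsub>D4\<^esub> = mat 1"
  by (simp_all add: D4_def subgroup_generated_def GL2Z_def)

lemma group_D4: "group D4"
  unfolding D4_def by (rule group.group_subgroup_generated[OF group_GL2Z])

lemma generators_order:
  "quarter_turn ** (quarter_turn ** (quarter_turn ** quarter_turn)) = mat 1"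
  "axis_reflection ** axis_reflection = mat 1"
  by (rule mat2_eqI; simp add: quarter_turn_def axis_reflection_def matrix_matrix_mult_def sum_2 mat_def)+

lemma generators_GL2Z: "{quarter_turn, axis_reflection} \<subseteq> carrier GL2Z"
proof -
  have "quarter_turn ** (quarter_turn ** (quarter_turn ** quarter_turn)) = mat 1"
    "(quarter_turn ** (quarter_turn ** quarter_turn)) ** quarter_turn = mat 1"
    using generators_order by (simp_all add: matrix_mul_assoc)
  thus ?thesis using generators_order(2) unfolding GL2Z_def invertible_def by auto
qed

lemma carrier_D4: "carrier D4 = generate GL2Z {quarter_turn, axis_reflection}"
  unfolding D4_def carrier_subgroup_generated
  using generators_GL2Z by (simp add: quarter_turn_def axis_reflection_def Int_absorb1)

lemma D4_GL2Z: "L \<in> carrier D4 \<Longrightarrow> L \<in> carrier GL2Z"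
  unfolding carrier_D4 using group.generate_incl[OF group_GL2Z generators_GL2Z] by blast

lemma D4_mult: "L \<in> carrier D4 \<Longrightarrow> K \<in> carrier D4 \<Longrightarrow> L ** K \<in> carrier D4"
  using group.is_monoid[OF group_D4] monoid.m_closed by fastforce

lemma D4_inverse:
  assumes "L \<in> carrier D4"
  obtains K where "K \<in> carrier D4" "L ** K = mat 1" "K ** L = mat 1"
  using group.inv_closed[OF group_D4 assms] group.l_inv[OF group_D4 assms] group.r_inv[OF group_D4 assms]
  by simp

definition preserves_hierarchy :: "int^2^2 \<Rightarrow> bool" where
  "preserves_hierarchy L \<longleftrightarrow>
     (\<forall>q. off_axes q \<longrightarrow> off_axes (L *v q) \<and> hier (L *v q) = tile_act L (hier q))"

lemma preserves_hierarchy_mult: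
  "preserves_hierarchy L \<Longrightarrow> preserves_hierarchy K \<Longrightarrow> preserves_hierarchy (L ** K)"
  by (simp add: preserves_hierarchy_def tile_act_mult flip: matrix_vector_mul_assoc)

lemma preserves_hierarchy_generators:
  "preserves_hierarchy quarter_turn" "preserves_hierarchy axis_reflection"
proof -
  have q: "(quarter_turn *v q) $ 1 = - q $ 2" "(quarter_turn *v q) $ 2 = q $ 1"
    "(axis_reflection *v q) $ 1 = - q $ 1" "(axis_reflection *v q) $ 2 = q $ 2" for q
    by (simp_all add: quarter_turn_def axis_reflection_def matrix_vector_mult_def sum_2)
  show "preserves_hierarchy quarter_turn"
    unfolding preserves_hierarchy_def tile_act_generators
    using hier_rotate q(1,2) by (auto simp: off_axes_def forall_2)
  show "preserves_hierarchy axis_reflection"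
    unfolding preserves_hierarchy_def tile_act_generators
    using hier_reflect q(3,4) by (auto simp: off_axes_def forall_2)
qed

lemma D4_preserves_hierarchy: "L \<in> carrier D4 \<Longrightarrow> preserves_hierarchy L"
  unfolding carrier_D4
proof (induction rule: generate.induct)
  case one
  show ?case by (simp add: preserves_hierarchy_def)
next
  case (incl h)
  thus ?case using preserves_hierarchy_generators by blast
next
  case (inv h)
  let ?q = quarter_turn
  have in_GL2Z: "?q \<in> carrier GL2Z" "axis_reflection \<in> carrier GL2Z" using generators_GL2Z by blast+
  have "?q ** ?q ** ?q \<in> carrier GL2Z"
    using monoid.m_closed[OF group.is_monoid[OF group_GL2Z]] in_GL2Z(1) unfolding GL2Z_simps by blast
  moreover have "?q ** ?q ** ?q ** ?q = mat 1" using generators_order(1) by (simp only: matrix_mul_assoc)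
  ultimately have "inv\<^bsub>GL2Z\<^esub> ?q = ?q ** ?q ** ?q" "inv\<^bsub>GL2Z\<^esub> axis_reflection = axis_reflection"
    using in_GL2Z generators_order(2) by (auto intro!: group.inv_equality[OF group_GL2Z])
  thus ?case using inv preserves_hierarchy_generators preserves_hierarchy_mult by auto
next
  case (eng h1 h2)
  thus ?case by (simp add: preserves_hierarchy_mult)
qed

text \<open>A zero in each row of \<open>K\<close> leaves a single product in each entry of
  \<open>K ** L\<close>, so the surviving entries are units. The eight resulting matrices are words
  in the two generators.\<close>

lemma signed_permutation_D4:
  fixes K L :: "int^2^2"
  assumes "L ** K = mat 1" "K ** L = mat 1" "\<And>i. \<exists>j. K $ i $ j = 0"
  shows "L \<in> carrier D4"
proof -
  let ?q = quarter_turn and ?s = axis_reflection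
  have eq: "(L ** K) $ i $ j = L $ i $ 1 * K $ 1 $ j + L $ i $ 2 * K $ 2 $ j"
    "(K ** L) $ i $ j = K $ i $ 1 * L $ 1 $ j + K $ i $ 2 * L $ 2 $ j" for i j
    by (simp_all add: matrix_matrix_mult_def sum_2)
  have m: "(mat 1 :: int^2^2) $ 1 $ 1 = 1" "(mat 1 :: int^2^2) $ 1 $ 2 = 0"
    "(mat 1 :: int^2^2) $ 2 $ 1 = 0" "(mat 1 :: int^2^2) $ 2 $ 2 = 1"
    by (simp_all add: mat_def)
  note KL = eq(2)[of 1 1, unfolded assms(2) m] eq(2)[of 1 2, unfolded assms(2) m]
    eq(2)[of 2 1, unfolded assms(2) m] eq(2)[of 2 2, unfolded assms(2) m]
  have unit: "a * b = 1 \<Longrightarrow> b = 1 \<or> b = -1" for a b :: int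
    by (metis minus_equation_iff mult.commute zmult_eq_1_iff)
  have z: "K $ 1 $ 1 = 0 \<or> K $ 1 $ 2 = 0" "K $ 2 $ 1 = 0 \<or> K $ 2 $ 2 = 0"
    using assms(3) by (metis exhaust_2)+
  have shape: "L $ 1 $ 2 = 0 \<and> L $ 2 $ 1 = 0 \<and> L $ 1 $ 1 \<in> {1, -1} \<and> L $ 2 $ 2 \<in> {1, -1} \<or>
      L $ 1 $ 1 = 0 \<and> L $ 2 $ 2 = 0 \<and> L $ 1 $ 2 \<in> {1, -1} \<and> L $ 2 $ 1 \<in> {1, -1}"
    using z KL unit by (elim disjE) auto
  have prods: "?q \<in> carrier D4" "?s \<in> carrier D4" "mat 1 \<in> carrier D4"
    unfolding carrier_D4 using generate.one[of GL2Z] by (auto intro: generate.incl)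
  have "L \<in> {mat 1, ?q, ?q ** ?q, ?q ** (?q ** ?q), ?s, ?q ** ?s, ?q ** (?q ** ?s), ?q ** (?q ** (?q ** ?s))}"
  proof -
    have entries: "X = Y \<longleftrightarrow> X $ 1 $ 1 = Y $ 1 $ 1 \<and> X $ 1 $ 2 = Y $ 1 $ 2 \<and> X $ 2 $ 1 = Y $ 2 $ 1 \<and> X $ 2 $ 2 = Y $ 2 $ 2"
      for X Y :: "int^2^2"
      by (auto intro: mat2_eqI)
    show ?thesis using shape
      by (simp add: entries[of L] m quarter_turn_def axis_reflection_def matrix_matrix_mult_def sum_2) presburger
  qed
  thus ?thesis using prods D4_mult by auto
qed

section \<open>The action of \<open>D4\<close> on configurations\<close>

definition config_act :: "int^2^2 \<Rightarrow> tile config \<Rightarrow> tile config" where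
  "config_act L x = (\<lambda>p. tile_act L (x (matrix_inv L *v p)))"

lemma matrix_inv_D4:
  assumes "L \<in> carrier D4"
  shows "L ** matrix_inv L = mat 1" "matrix_inv L ** L = mat 1"
proof -
  have "\<exists>K. L ** K = mat 1 \<and> K ** L = mat 1" using D4_inverse[OF assms] by blast
  hence "L ** matrix_inv L = mat 1 \<and> matrix_inv L ** L = mat 1"
    unfolding matrix_inv_def by (rule someI_ex)
  thus "L ** matrix_inv L = mat 1" "matrix_inv L ** L = mat 1" by simp_all
qed

lemma config_act_apply:
  assumes "L \<in> carrier D4"
  shows "config_act L x (L *v p) = tile_act L (x p)"
  by (simp add: config_act_def matrix_vector_mul_assoc matrix_inv_D4[OF assms])

lemma config_act_mult:
  assumes "L \<in> carrier D4" "K \<in> carrier D4"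
  shows "config_act (L ** K) x = config_act L (config_act K x)"
proof
  fix p
  define q where "q = matrix_inv K *v (matrix_inv L *v p)"
  have K: "K *v q = matrix_inv L *v p"
    by (simp add: q_def matrix_vector_mul_assoc matrix_mul_assoc matrix_inv_D4[OF assms(2)])
  have p: "p = L *v (K *v q)" by (simp add: K matrix_vector_mul_assoc matrix_inv_D4[OF assms(1)])
  hence p': "p = (L ** K) *v q" by (simp add: matrix_vector_mul_assoc)
  show "config_act (L ** K) x p = config_act L (config_act K x) p"
    by (subst p', subst p)
      (simp only: config_act_apply D4_mult assms tile_act_mult)
qed

lemma config_act_1: "config_act (mat 1) x = x"
proof -
  have "mat 1 \<in> carrier D4" using group.is_monoid[OF group_D4] monoid.one_closed by fastforce
  from config_act_apply[OF this] show ?thesis by (simp add: fun_eq_iff)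
qed

lemma config_act_shift:
  assumes "L \<in> carrier D4"
  shows "config_act L (shift g x) = shift (L *v g) (config_act L x)"
proof
  fix p
  have p: "p = L *v (matrix_inv L *v p)"
    by (simp add: matrix_vector_mul_assoc matrix_inv_D4[OF assms])
  have "config_act L (shift g x) p = tile_act L (x (matrix_inv L *v p - g))"
    by (simp add: config_act_def shift_apply)
  also have "\<dots> = config_act L x (L *v (matrix_inv L *v p - g))"
    by (rule config_act_apply[OF assms, symmetric])
  also have "\<dots> = shift (L *v g) (config_act L x) p"
    using p by (simp add: matrix_vector_mult_diff_distrib shift_apply)
  finally show "config_act L (shift g x) p = shift (L *v g) (config_act L x) p" .
qed

lemma linear_square:
  "\<exists>m'. \<forall>p \<in> square m. L *v p \<in> square m'"
proof -
  obtain m' where "(\<lambda>p. L *v p) ` square m \<subseteq> square m'"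
    using finite_subset_square[OF finite_imageI[OF finite_square]] .
  thus ?thesis by (auto simp: image_subset_iff)
qed

lemma config_act_rob_min:
  assumes "L \<in> carrier D4" "x \<in> rob_min"
  shows "config_act L x \<in> rob_min"
  unfolding rob_min_def
proof (intro CollectI allI)
  fix m
  obtain m' where m': "\<And>p. p \<in> square m \<Longrightarrow> matrix_inv L *v p \<in> square m'"
    using linear_square[of m "matrix_inv L"] by blast
  obtain g where g: "located m' g x" using assms(2) unfolding rob_min_def by blast
  have "located m (L *v g) (config_act L x)"
    unfolding located_def
  proof
    fix p assume p: "p \<in> square m"
    define q where "q = matrix_inv L *v p"
    have pq: "p = L *v q" by (simp add: q_def matrix_vector_mul_assoc matrix_inv_D4[OF assms(1)])
    have q: "off_axes (q - g)" "x q = hier (q - g)"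
      using located_apply[OF g m'[OF p]] by (simp_all add: q_def)
    have "off_axes (L *v (q - g)) \<and> hier (L *v (q - g)) = tile_act L (hier (q - g))"
      using D4_preserves_hierarchy[OF assms(1)] q(1) unfolding preserves_hierarchy_def by blast
    thus "off_axes (p - L *v g) \<and> config_act L x p = hier (p - L *v g)"
      using q(2) by (simp add: pq config_act_apply[OF assms(1)] matrix_vector_mult_diff_distrib)
  qed
  thus "\<exists>g. located m g (config_act L x)" by blast
qed

lemma continuous_map_pointwise_code:
  assumes "X \<subseteq> topspace (full_shift A)" "\<And>x. x \<in> X \<Longrightarrow> f x \<in> X"
    and code: "\<And>p x. x \<in> X \<Longrightarrow> f x p = \<phi> p (x (\<pi> p))"
  shows "continuous_map (subtopology (full_shift A) X) (subtopology (full_shift A) X) f"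
proof -
  have top: "topspace (subtopology (full_shift A) X) = X"
    using assms(1) by (simp add: Int_absorb1)
  have "continuous_map (subtopology (full_shift A) X) (discrete_topology A) (\<lambda>x. f x p)" for p
    unfolding continuous_map_def
  proof (intro conjI allI impI)
    show "(\<lambda>x. f x p) \<in> topspace (subtopology (full_shift A) X) \<rightarrow> topspace (discrete_topology A)"
      using assms(1,2) unfolding top by (auto simp: topspace_full_shift subset_iff)
    fix U assume "openin (discrete_topology A) U"
    have "continuous_map (full_shift A) (discrete_topology A) (\<lambda>x. x (\<pi> p))"
      unfolding full_shift_def by (rule continuous_map_product_projection) simp
    hence "continuous_map (subtopology (full_shift A) X) (discrete_topology A) (\<lambda>x. x (\<pi> p))"
      by (rule continuous_map_from_subtopology)
    hence "openin (subtopology (full_shift A) X)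
        {x \<in> topspace (subtopology (full_shift A) X). x (\<pi> p) \<in> {a \<in> A. \<phi> p a \<in> U}}"
      by (rule openin_continuous_map_preimage) auto
    also have "{x \<in> topspace (subtopology (full_shift A) X). x (\<pi> p) \<in> {a \<in> A. \<phi> p a \<in> U}} =
        {x \<in> topspace (subtopology (full_shift A) X). f x p \<in> U}"
      using assms(1) code unfolding top by (auto simp: topspace_full_shift subset_iff)
    finally show "openin (subtopology (full_shift A) X)
        {x \<in> topspace (subtopology (full_shift A) X). f x p \<in> U}" .
  qed
  hence "continuous_map (subtopology (full_shift A) X) (full_shift A) f"
    unfolding full_shift_def continuous_map_componentwise_UNIV by blast
  thus ?thesis using assms(2) top by (auto simp: continuous_map_in_subtopology)
qed

section \<open>The group of affine symmetries\<close>

definition affine_symmetry :: "(int^2) \<times> (int^2^2) \<Rightarrow> tile config \<Rightarrow> tile config" where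
  "affine_symmetry a = (\<lambda>x\<in>rob_min. shift (fst a) (config_act (snd a) x))"

lemma affine_symmetry_in:
  assumes "L \<in> carrier D4" "x \<in> rob_min"
  shows "affine_symmetry (g, L) x \<in> rob_min"
  using assms by (simp add: affine_symmetry_def rob_min_shift config_act_rob_min)

lemma affine_symmetry_mult:
  assumes "L \<in> carrier D4" "K \<in> carrier D4" "x \<in> rob_min"
  shows "affine_symmetry (g + L *v h, L ** K) x = affine_symmetry (g, L) (affine_symmetry (h, K) x)"
  using assms by (simp add: affine_symmetry_def rob_min_shift config_act_rob_min config_act_mult config_act_shift)

lemma affine_symmetry_1: "x \<in> rob_min \<Longrightarrow> affine_symmetry (0, mat 1) x = x"
  by (simp add: affine_symmetry_def config_act_1)

text \<open>The inverse is taken from the semidirect product: \<open>(- (K *v g), K)\<close> with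
  \<open>K\<close> inverse to \<open>L\<close>.\<close>

lemma affine_symmetry_Bij:
  assumes "L \<in> carrier D4"
  shows "affine_symmetry (g, L) \<in> Bij rob_min"
proof -
  obtain K where K: "K \<in> carrier D4" "L ** K = mat 1" "K ** L = mat 1" using D4_inverse[OF assms] .
  have KL: "L *v (K *v g) = g" by (simp add: matrix_vector_mul_assoc K)
  have neg: "L *v (- (K *v g)) = - g"
    using KL matrix_vector_mult_diff_distrib[of L 0 "K *v g"] by simp
  have "affine_symmetry (g, L) (affine_symmetry (- (K *v g), K) x) = x"
    "affine_symmetry (- (K *v g), K) (affine_symmetry (g, L) x) = x" if "x \<in> rob_min" for x
    using affine_symmetry_mult[OF assms K(1) that, of g "- (K *v g)"]
      affine_symmetry_mult[OF K(1) assms that, of "- (K *v g)" g]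
    by (simp_all add: K neg affine_symmetry_1[OF that])
  hence "bij_betw (affine_symmetry (g, L)) rob_min rob_min"
    using affine_symmetry_in assms K(1)
    by (intro bij_betw_byWitness[where f' = "affine_symmetry (- (K *v g), K)"]) auto
  thus ?thesis by (simp add: Bij_def affine_symmetry_def)
qed

lemma affine_symmetry_equivariant:
  assumes "L \<in> carrier D4" "x \<in> rob_min"
  shows "affine_symmetry (g, L) (shift p x) = shift (L *v p) (affine_symmetry (g, L) x)"
  using assms by (simp add: affine_symmetry_def rob_min_shift config_act_shift add.commute)

lemma rob_min_topspace: "rob_min \<subseteq> topspace (full_shift robinson_tiles)"
  using closedin_rob_min by (rule closedin_subset)

lemma affine_symmetry_Sym:
  assumes "L \<in> carrier D4"
  shows "affine_symmetry (g, L) \<in> carrier (Sym robinson_tiles rob_min)"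
proof -
  have "continuous_map (subtopology (full_shift robinson_tiles) rob_min)
      (subtopology (full_shift robinson_tiles) rob_min) (affine_symmetry (g, L))"
    by (rule continuous_map_pointwise_code[where \<phi> = "\<lambda>_. tile_act L" and \<pi> = "\<lambda>p. matrix_inv L *v (p - g)"])
      (simp_all add: rob_min_topspace affine_symmetry_in[OF assms],
       simp add: affine_symmetry_def shift_apply config_act_def)
  moreover have "bij_betw (affine_symmetry (g, L)) rob_min rob_min"
    using affine_symmetry_Bij[OF assms] by (simp add: Bij_def)
  ultimately have "extended_symmetry robinson_tiles rob_min (affine_symmetry (g, L))"
    unfolding extended_symmetry_def using D4_GL2Z[OF assms] affine_symmetry_equivariant[OF assms] by blast
  thus ?thesis using affine_symmetry_Bij[OF assms] by (simp add: Sym_def)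
qed

text \<open>Equivariance exhibits \<open>L *v p - K *v p\<close> as a period, and then equality of
  values exhibits \<open>g - h\<close> as one; both vanish by aperiodicity.\<close>

lemma affine_symmetry_inj:
  assumes "L \<in> carrier D4" "K \<in> carrier D4" "affine_symmetry (g, L) = affine_symmetry (h, K)"
  shows "g = h \<and> L = K"
proof -
  have x: "central 1 True \<in> rob_min" by (rule central_in_rob_min)
  define z where "z = affine_symmetry (g, L) (central 1 True)"
  have z: "z \<in> rob_min" unfolding z_def using assms(1) x by (rule affine_symmetry_in)
  have "L *v p = K *v p" for p
  proof -
    have eq: "shift (L *v p) z = shift (K *v p) z"
      using affine_symmetry_equivariant[OF assms(1) x, of g p] affine_symmetry_equivariant[OF assms(2) x, of h p]
      by (simp add: z_def assms(3))
    have "shift (L *v p - K *v p) z = shift (- (K *v p)) (shift (L *v p) z)" by simp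
    also have "\<dots> = z" by (simp add: eq)
    finally have "L *v p - K *v p = 0" by (rule rob_min_aperiodic[OF z])
    thus ?thesis by simp
  qed
  hence LK: "L = K" by (simp add: matrix_eq)
  define w where "w = config_act L (central 1 True)"
  have w: "w \<in> rob_min" unfolding w_def using assms(1) x by (rule config_act_rob_min)
  have eq: "shift g w = shift h w"
    using fun_cong[OF assms(3), of "central 1 True"] x LK by (simp add: affine_symmetry_def w_def)
  have "shift (g - h) w = shift (- h) (shift g w)" by simp
  also have "\<dots> = w" by (simp add: eq)
  finally have "g - h = 0" by (rule rob_min_aperiodic[OF w])
  with LK show ?thesis by simp
qed

text \<open>By \<open>central_image\<close> each row of the inverse matrix contains a zero, so the
  matrix lies in \<open>D4\<close>. Composing with \<open>config_act K\<close> cancels the linear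
  part and leaves a map that commutes with shifts.\<close>

lemma extended_symmetry_affine:
  assumes "f \<in> carrier (Sym robinson_tiles rob_min)"
  obtains g L where "L \<in> carrier D4" "f = affine_symmetry (g, L)"
proof -
  let ?X = "subtopology (full_shift robinson_tiles) rob_min"
  have f: "f \<in> Bij rob_min" "bij_betw f rob_min rob_min" "continuous_map ?X ?X f"
    and "\<exists>L \<in> carrier GL2Z. \<forall>p. \<forall>x\<in>rob_min. f (shift p x) = shift (L *v p) (f x)"
    using assms by (auto simp: Sym_def extended_symmetry_def)
  then obtain L where L: "L \<in> carrier GL2Z" "\<And>p x. x \<in> rob_min \<Longrightarrow> f (shift p x) = shift (L *v p) (f x)"
    by blast
  obtain K where K: "L ** K = mat 1" "K ** L = mat 1"
    using L(1) by (auto simp: GL2Z_def invertible_def)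
  obtain r where r: "\<And>x y p. x \<in> rob_min \<Longrightarrow> y \<in> rob_min \<Longrightarrow> \<forall>h\<in>square r. x (p + h) = y (p + h) \<Longrightarrow>
      f x (L *v p) = f y (L *v p)"
    using sliding_block_code[OF finite_robinson_tiles subshift_rob_min f(3) L(2)] by blast
  have f_in: "f x \<in> rob_min" if "x \<in> rob_min" for x using f(2) that by (rule bij_betw_apply)
  interpret f: hierarchy_symmetry f L K r
    by unfold_locales (fact f_in bij_betw_imp_inj_on[OF f(2)] K L(2) r)+
  have LD: "L \<in> carrier D4"
  proof (rule signed_permutation_D4[OF K])
    show "\<exists>j. K $ i $ j = 0" for i using f.central_image[of i] by blast
  qed
  obtain K' where K': "K' \<in> carrier D4" "L ** K' = mat 1" "K' ** L = mat 1" using D4_inverse[OF LD] .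
  have "K' = K" by (metis K K' matrix_mul_assoc matrix_mul_lid matrix_mul_rid)
  with K' have KD: "K \<in> carrier D4" by simp
  define f' where "f' x = f (config_act K x)" for x
  \<comment> \<open>A radius for \<open>f'\<close>: the block of radius \<open>r\<close> that
    \<open>f\<close> reads at \<open>K *v p\<close> consists of tiles of \<open>x\<close> at the
    positions \<open>p + L *v h\<close>.\<close>
  obtain r' where r': "\<And>h. h \<in> square r \<Longrightarrow> L *v h \<in> square r'"
    using linear_square[of r L] by blast
  have "hierarchy_symmetry f' (mat 1) (mat 1) r'"
  proof
    show "f' x \<in> rob_min" if "x \<in> rob_min" for x
      unfolding f'_def by (intro f_in config_act_rob_min KD that)
    show "inj_on f' rob_min"
    proof (rule inj_onI)
      fix x y assume xy: "x \<in> rob_min" "y \<in> rob_min" "f' x = f' y"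
      have "config_act K x = config_act K y"
        using xy f.f_inj config_act_rob_min[OF KD] unfolding f'_def by (meson inj_onD)
      hence "config_act (L ** K) x = config_act (L ** K) y" by (simp add: config_act_mult[OF LD KD])
      thus "x = y" by (simp add: K config_act_1)
    qed
    show "f' (shift p x) = shift (mat 1 *v p) (f' x)" if "x \<in> rob_min" for p x
      using L(2)[OF config_act_rob_min[OF KD that]]
      by (simp add: f'_def config_act_shift[OF KD] matrix_vector_mul_assoc K)
    show "f' x (mat 1 *v p) = f' y (mat 1 *v p)"
      if xy: "x \<in> rob_min" "y \<in> rob_min" "\<forall>h\<in>square r'. x (p + h) = y (p + h)" for x y p
    proof -
      have act: "config_act K z (K *v p + h) = tile_act K (z (p + L *v h))" for z h
      proof -
        have "K *v p + h = K *v (p + L *v h)"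
          by (simp add: matrix_vector_right_distrib matrix_vector_mul_assoc K)
        thus ?thesis by (simp add: config_act_apply[OF KD])
      qed
      have "f (config_act K x) (L *v (K *v p)) = f (config_act K y) (L *v (K *v p))"
        by (intro r config_act_rob_min KD xy ballI) (use xy(3) r' in \<open>simp add: act\<close>)
      thus ?thesis by (simp add: f'_def matrix_vector_mul_assoc K)
    qed
  qed (simp_all)
  then obtain g where g: "\<And>y. y \<in> rob_min \<Longrightarrow> f' y = shift g y"
    using equivariant_identity_is_shift by blast
  have "f x = affine_symmetry (g, L) x" for x
  proof (cases "x \<in> rob_min")
    case True
    have "f x = f' (config_act L x)"
      by (simp add: f'_def K config_act_1 flip: config_act_mult[OF KD LD])
    thus ?thesis using True g[OF config_act_rob_min[OF LD True]] by (simp add: affine_symmetry_def)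
  next
    case False
    thus ?thesis using f(1) by (simp add: affine_symmetry_def Bij_def extensional_def)
  qed
  with LD that show ?thesis by blast
qed

lemma semidirect_Z2_D4_simps [simp]:
  "carrier (semidirect_product Z2 D4 (*v)) = UNIV \<times> carrier D4"
  "(g, L) \<otimes>\<^bsub>semidirect_product Z2 D4 (*v)\<^esub> (h, K) = (g + L *v h, L ** K)"
  "\<one>\<^bsub>semidirect_product Z2 D4 (*v)\<^esub> = (0, mat 1)"
  by (simp_all add: semidirect_product_def Z2_def)

text \<open>The isomorphism \<open>affine_symmetry\<close> starts from this product; knowing that it
  is a group allows the isomorphism to be reversed.\<close>

lemma group_semidirect_Z2_D4: "group (semidirect_product Z2 D4 (*v))"
proof (rule groupI)
  fix a assume "a \<in> carrier (semidirect_product Z2 D4 (*v))"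
  then obtain g L where a: "a = (g, L)" "L \<in> carrier D4" by auto
  obtain K where K: "K \<in> carrier D4" "L ** K = mat 1" "K ** L = mat 1" using D4_inverse[OF a(2)] .
  have "(- (K *v g), K) \<otimes>\<^bsub>semidirect_product Z2 D4 (*v)\<^esub> a = \<one>\<^bsub>semidirect_product Z2 D4 (*v)\<^esub>"
    by (simp add: a K)
  thus "\<exists>b\<in>carrier (semidirect_product Z2 D4 (*v)). b \<otimes>\<^bsub>semidirect_product Z2 D4 (*v)\<^esub> a = \<one>\<^bsub>semidirect_product Z2 D4 (*v)\<^esub>"
    using K(1) by (intro bexI[of _ "(- (K *v g), K)"]) auto
qed (use monoid.one_closed[OF group.is_monoid[OF group_D4]] in
      \<open>auto simp: D4_mult matrix_mul_assoc matrix_vector_right_distrib matrix_vector_mul_assoc\<close>)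

lemma affine_symmetry_iso:
  "affine_symmetry \<in> iso (semidirect_product Z2 D4 (*v)) (Sym robinson_tiles rob_min)"
proof -
  let ?S = "semidirect_product Z2 D4 (*v)" and ?G = "Sym robinson_tiles rob_min"
  have "affine_symmetry \<in> hom ?S ?G"
  proof (rule homI)
    fix a assume "a \<in> carrier ?S"
    thus "affine_symmetry a \<in> carrier ?G" using affine_symmetry_Sym by auto
  next
    fix a b assume "a \<in> carrier ?S" "b \<in> carrier ?S"
    then obtain g L h K where ab: "a = (g, L)" "b = (h, K)" "L \<in> carrier D4" "K \<in> carrier D4" by auto
    have "affine_symmetry (g, L) \<otimes>\<^bsub>?G\<^esub> affine_symmetry (h, K)
        = compose rob_min (affine_symmetry (g, L)) (affine_symmetry (h, K))"
      using affine_symmetry_Bij ab by (simp add: Sym_def BijGroup_def)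
    also have "\<dots> = affine_symmetry (g + L *v h, L ** K)"
    proof
      fix x
      show "compose rob_min (affine_symmetry (g, L)) (affine_symmetry (h, K)) x = affine_symmetry (g + L *v h, L ** K) x"
        using affine_symmetry_mult[OF ab(3,4), of x g h]
        by (cases "x \<in> rob_min") (simp_all add: compose_def, simp add: affine_symmetry_def)
    qed
    finally show "affine_symmetry (a \<otimes>\<^bsub>?S\<^esub> b) = affine_symmetry a \<otimes>\<^bsub>?G\<^esub> affine_symmetry b"
      by (simp add: ab)
  qed
  moreover have "bij_betw affine_symmetry (carrier ?S) (carrier ?G)"
    unfolding bij_betw_def
  proof
    show "inj_on affine_symmetry (carrier ?S)"
      using affine_symmetry_inj by (auto intro!: inj_onI)
    show "affine_symmetry ` carrier ?S = carrier ?G"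
    proof
      show "affine_symmetry ` carrier ?S \<subseteq> carrier ?G" using affine_symmetry_Sym by auto
      show "carrier ?G \<subseteq> affine_symmetry ` carrier ?S"
      proof
        fix f assume "f \<in> carrier ?G"
        then obtain g L where "L \<in> carrier D4" "f = affine_symmetry (g, L)" by (rule extended_symmetry_affine)
        thus "f \<in> affine_symmetry ` carrier ?S" by auto
      qed
    qed
  qed
  ultimately show ?thesis by (simp add: iso_def)
qed

theorem corollary23:
  fixes M_Rob :: "tile config set"
  assumes "M_Rob \<subseteq> X_Rob"
    and "minimal_subshift robinson_tiles M_Rob"
    and "\<And>M. M \<subseteq> X_Rob \<Longrightarrow> minimal_subshift robinson_tiles M \<Longrightarrow> M = M_Rob"
  shows "Sym robinson_tiles M_Rob \<cong> semidirect_product Z2 D4 (*v)"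
proof -
  have "rob_min \<noteq> {}" using central_in_rob_min by blast
  hence "rob_min = M_Rob" using assms(3) rob_min_X_Rob minimal_rob_min by blast
  moreover have "semidirect_product Z2 D4 (*v) \<cong> Sym robinson_tiles rob_min"
    using affine_symmetry_iso unfolding is_iso_def by blast
  ultimately show ?thesis
    using group.iso_sym[OF group_semidirect_Z2_D4] by blast
qed

end
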